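(* Assume that the set-valued map $K\setminus O\ni x\mapsto A(x)\subseteq A$ is compact-valued, upper hemicontinuous and weakly measurable, and that $Q$ is strongly Feller on $\mathbb K$, i.e. $\mathbb K\ni(x,a)\mapsto\int_X Q(\mathrm dy|x,a)g(y)$ is continuous and bounded for every bounded measurable $g:X\to\mathbb R$. Let $\pi\in\Pi$ be a policy and $x\in X$. Then: (1) $\pi$ is equalizing at $x$ if and only if $$\lim_{n\to\infty}\mathsf E^\pi_x\bigl[\mathbf 1_{K\setminus O}(x_{(n-1)\wedge\tau\wedge\tau'})\,(\mathbf 1_K V^\star)(x_{n\wedge\tau\wedge\tau'})\bigr]=0;$$ (2) $\pi$ is optimal at $x$ (i.e. $V(\pi,x)=V^\star(x)$) if and only if $\pi$ is both thrifty and equalizing at $x$.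
   Context: A Borel space is a Borel subset of a Polish space, with Borel $\sigma$-algebra $\mathfrak B(\cdot)$; "measurable" means Borel measurable. $X$ (states) and $A$ (actions) are nonempty Borel spaces; for each $x\in X$, $A(x)$ is a nonempty measurable subset of $A$ (feasible actions); the set $\mathbb K_X=\{(x,a):x\in X,\ a\in A(x)\}$ is measurable in $X\times A$ and contains the graph of a measurable function $X\to A$; $Q$ is a stochastic kernel on $X$ given $\mathbb K_X$. $O\subsetneq K$ are nonempty measurable subsets of $X$. $\mathbb N_0=\{0,1,2,\dots\}$, $\mathbb N=\{1,2,\dots\}$, $a\wedge b=\min\{a,b\}$. Write $\mathbb K=\{(x,a):x\in K\setminus O,\ a\in A(x)\}$. A policy $\pi=(\pi_t)_{t\in\mathbb N_0}$ is a sequence of stochastic kernels $\pi_t$ on $A$ given the histories $h_t=(x_0,a_0,\dots,x_{t-1},a_{t-1},x_t)$ with $\pi_t(A(x_t)|h_t)=1$; $\Pi$ is the set of all (randomized, history-dependent) policies. Under $\mathsf P^\pi_x$ (expectation $\mathsf E^\pi_x$) one has $x_0=x$, $a_t$ has conditional law $\pi_t(\cdot|h_t)$ given $h_t$, and $x_{t+1}$ has conditional law $Q(\cdot|x_t,a_t)$ given $(h_t,a_t)$. Let $\tau=\inf\{t\in\mathbb N_0: x_t\in O\}$ and $\tau'=\inf\{t\in\mathbb N_0:x_t\in X\setminus K\}$ ($\inf\emptyset=\infty$), and $$V(\pi,x)=\mathsf P^\pi_x(\tau<\tau',\ \tau<\infty),\qquad V^\star(x)=\sup_{\pi\in\Pi}V(\pi,x).$$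 The process is regarded as killed at $\tau\wedge\tau'$: policies prescribe $\pi_t$ only on $\{t<\tau\wedge\tau'\}$. Nothing below depends on actions taken at times $\ge\tau\wedge\tau'$; they may be taken to be given by an arbitrary fixed feasible measurable rule. For $x\in X$, $\pi\in\Pi$ and $n\in\mathbb N$ put $W_n(\pi,x)=\sum_{t=0}^{(n-1)\wedge\tau\wedge\tau'}\mathbf 1_O(x_t)$, and define $$\zeta_0=V^\star(x),\qquad \zeta_n=W_n(\pi,x)+\mathbf 1_{K\setminus O}(x_{(n-1)\wedge\tau\wedge\tau'})\,(\mathbf 1_K V^\star)(x_{n\wedge\tau\wedge\tau'}),\quad n\in\mathbb N .$$ Let $\Lambda^\pi(x)=\lim_{n\to\infty}\mathsf E^\pi_x[\zeta_n]$ (the sequence $\mathsf E^\pi_x[\zeta_n]$ is nonincreasing and nonnegative). A policy $\pi$ is thrifty at $x$ if $V^\star(x)=\Lambda^\pi(x)$, and equalizing at $x$ if $\Lambda^\pi(x)=V(\pi,x)$. A set-valued map $\Psi$ is upper hemicontinuous if for every $x$ and every open neighbourhood $U$ of $\Psi(x)$ there is a neighbourhood $W$ of $x$ with $\Psi(z)\subseteq U$ for $z\in W$; it is weakly measurable if $\{x:\Psi(x)\cap G\ne\emptyset\}$ is measurable for every open $G$. *)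

theory Defs
  imports "HOL-Probability.Probability"
begin

section \<open>Set-valued maps\<close>

text \<open>
  All topologies are subspace topologies: \<open>\<Psi>\<close> maps points of \<open>S\<close> to subsets of \<open>Y\<close>.
\<close>

definition upper_hemicontinuous_on ::
    "'x::topological_space set \<Rightarrow> 'a::topological_space set \<Rightarrow> ('x \<Rightarrow> 'a set) \<Rightarrow> bool" where
  "upper_hemicontinuous_on S Y \<Psi> \<longleftrightarrow>
     (\<forall>x\<in>S. \<forall>U. openin (top_of_set Y) U \<and> \<Psi> x \<subseteq> U \<longrightarrow>
        (\<exists>W. openin (top_of_set S) W \<and> x \<in> W \<and> (\<forall>z\<in>W. \<Psi> z \<subseteq> U)))"

definition weakly_measurable_on ::
    "'x::topological_space set \<Rightarrow> 'a::topological_space set \<Rightarrow> ('x \<Rightarrow> 'a set) \<Rightarrow> bool" where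
  "weakly_measurable_on S Y \<Psi> \<longleftrightarrow>
     (\<forall>G. openin (top_of_set Y) G \<longrightarrow>
        {x\<in>S. \<Psi> x \<inter> G \<noteq> {}} \<in> sets (restrict_space borel S))"

section \<open>The controlled process\<close>

record ('x, 'a) reach_avoid_data =
  states   :: "'x set"
  actions  :: "'a set"
  feasible :: "'x \<Rightarrow> 'a set"
  trans_kernel :: "'x \<times> 'a \<Rightarrow> 'x measure"
  target   :: "'x set"
  safe     :: "'x set"

definition state_space :: "('x::polish_space, 'a::polish_space) reach_avoid_data \<Rightarrow> 'x measure" where
  "state_space M = restrict_space borel (states M)"

definition action_space :: "('x::polish_space, 'a::polish_space) reach_avoid_data \<Rightarrow> 'a measure" where
  "action_space M = restrict_space borel (actions M)"

definition feasible_pairs :: "('x::polish_space, 'a::polish_space) reach_avoid_data \<Rightarrow> ('x \<times> 'a) set" where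
  "feasible_pairs M = {(x, a). x \<in> states M \<and> a \<in> feasible M x}"

definition pair_space :: "('x::polish_space, 'a::polish_space) reach_avoid_data \<Rightarrow> ('x \<times> 'a) measure" where
  "pair_space M = restrict_space (state_space M \<Otimes>\<^sub>M action_space M) (feasible_pairs M)"

definition live_pairs :: "('x::polish_space, 'a::polish_space) reach_avoid_data \<Rightarrow> ('x \<times> 'a) set" where
  "live_pairs M = {(x, a). x \<in> safe M - target M \<and> a \<in> feasible M x}"

locale reach_avoid =
  fixes M :: "('x::polish_space, 'a::polish_space) reach_avoid_data"
  assumes states: "states M \<noteq> {}" "states M \<in> sets borel"
    and actions: "actions M \<noteq> {}" "actions M \<in> sets borel"
    and feasible: "\<And>x. x \<in> states M \<Longrightarrow> feasible M x \<noteq> {} \<and> feasible M x \<in> sets (action_space M)"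
    and feasible_pairs: "feasible_pairs M \<in> sets (state_space M \<Otimes>\<^sub>M action_space M)"
    and selector: "\<exists>f \<in> state_space M \<rightarrow>\<^sub>M action_space M. \<forall>x\<in>states M. (x, f x) \<in> feasible_pairs M"
    and kernel: "trans_kernel M \<in> pair_space M \<rightarrow>\<^sub>M prob_algebra (state_space M)"
    and target: "target M \<noteq> {}" "target M \<in> sets (state_space M)"
    and safe: "safe M \<in> sets (state_space M)" "target M \<subset> safe M"

text \<open>
  A history \<open>(x\<^sub>0, a\<^sub>0, \<dots>, x\<^sub>t\<^sub>-\<^sub>1, a\<^sub>t\<^sub>-\<^sub>1, x\<^sub>t)\<close> is represented as \<open>(h, x\<^sub>t)\<close> with
  \<open>h i = (x\<^sub>i, a\<^sub>i)\<close> a feasible pair for \<open>i < t\<close>.  Policies prescribe actions at all times;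
  those at and after the killing time are irrelevant to every quantity below.
\<close>

definition history_space ::
    "('x::polish_space, 'a::polish_space) reach_avoid_data \<Rightarrow> nat \<Rightarrow> ((nat \<Rightarrow> 'x \<times> 'a) \<times> 'x) measure" where
  "history_space M t = (\<Pi>\<^sub>M i\<in>{0..<t}. pair_space M) \<Otimes>\<^sub>M state_space M"

type_synonym ('x, 'a) policy = "nat \<Rightarrow> (nat \<Rightarrow> 'x \<times> 'a) \<times> 'x \<Rightarrow> 'a measure"

definition policies :: "('x::polish_space, 'a::polish_space) reach_avoid_data \<Rightarrow> ('x, 'a) policy set" where
  "policies M = {\<pi>. \<forall>t. \<pi> t \<in> history_space M t \<rightarrow>\<^sub>M prob_algebra (action_space M) \<and>
     (\<forall>(h, x) \<in> space (history_space M t). measure (\<pi> t (h, x)) (feasible M x) = 1)}"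

text \<open>
  Conditional law of \<open>(x\<^sub>t, a\<^sub>t)\<close> given \<open>(x\<^sub>0, a\<^sub>0, \<dots>, x\<^sub>t\<^sub>-\<^sub>1, a\<^sub>t\<^sub>-\<^sub>1)\<close>; it is concentrated on the feasible
  pairs, so restricting it to them loses no mass.
\<close>

definition step_kernel ::
    "('x::polish_space, 'a::polish_space) reach_avoid_data \<Rightarrow> ('x, 'a) policy \<Rightarrow> 'x \<Rightarrow>
     nat \<Rightarrow> (nat \<Rightarrow> 'x \<times> 'a) \<Rightarrow> ('x \<times> 'a) measure" where
  "step_kernel M \<pi> x t h =
     restrict_space
       (do {
          y \<leftarrow> (case t of 0 \<Rightarrow> return (state_space M) x | Suc s \<Rightarrow> trans_kernel M (h s));
          a \<leftarrow> \<pi> t (h, y);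
          return (state_space M \<Otimes>\<^sub>M action_space M) (y, a)
        })
       (feasible_pairs M)"

text \<open>The law of the whole trajectory \<open>t \<mapsto> (x\<^sub>t, a\<^sub>t)\<close>, by the Ionescu-Tulcea extension theorem.\<close>

definition path_law ::
    "('x::polish_space, 'a::polish_space) reach_avoid_data \<Rightarrow> ('x, 'a) policy \<Rightarrow> 'x \<Rightarrow> (nat \<Rightarrow> 'x \<times> 'a) measure" where
  "path_law M \<pi> x =
     projective_family.lim UNIV
       (Ionescu_Tulcea.CI (step_kernel M \<pi> x) (\<lambda>_. pair_space M)) (\<lambda>_. pair_space M)"

lemma (in reach_avoid) step_kernel_Ionescu_Tulcea:
  assumes \<pi>: "\<pi> \<in> policies M" and x: "x \<in> states M"
  shows "Ionescu_Tulcea (step_kernel M \<pi> x) (\<lambda>_. pair_space M)"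
proof -
  let ?X = "state_space M" and ?A = "action_space M" and ?F = "feasible_pairs M"
  let ?B = "?X \<Otimes>\<^sub>M ?A"
  define start where "start t h = (case t of 0 \<Rightarrow> return ?X x | Suc s \<Rightarrow> trans_kernel M (h s))" for t h
  define joint where "joint t h = start t h \<bind> (\<lambda>y. \<pi> t (h, y) \<bind> (\<lambda>a. return ?B (y, a)))" for t h
  have space_X: "space ?X = states M"
    by (simp add: state_space_def space_restrict_space)
  have F: "?F \<noteq> {}" "?F \<in> sets ?B"
    using states feasible feasible_pairs by (auto simp: feasible_pairs_def)
  have start: "start t \<in> (\<Pi>\<^sub>M i\<in>{0..<t}. pair_space M) \<rightarrow>\<^sub>M prob_algebra ?X" for t
  proof (cases t)
    case 0
    have "return ?X x \<in> space (prob_algebra ?X)"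
      using x by (simp add: space_X space_prob_algebra prob_space_return)
    then show ?thesis
      by (simp add: start_def[abs_def] 0)
  next
    case (Suc s)
    have "(\<lambda>h. h s) \<in> (\<Pi>\<^sub>M i\<in>{0..<t}. pair_space M) \<rightarrow>\<^sub>M pair_space M"
      using Suc by (intro measurable_component_singleton) auto
    from measurable_compose[OF this kernel] show ?thesis
      by (simp add: start_def[abs_def] Suc)
  qed
  have pol: "\<pi> t \<in> (\<Pi>\<^sub>M i\<in>{0..<t}. pair_space M) \<Otimes>\<^sub>M ?X \<rightarrow>\<^sub>M prob_algebra ?A" for t
    using \<pi> by (simp add: policies_def history_space_def)
  have pol_F: "AE a in \<pi> t (h, y). (y, a) \<in> ?F"
    if h: "h \<in> space (\<Pi>\<^sub>M i\<in>{0..<t}. pair_space M)" and y: "y \<in> space ?X" for t h y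
  proof -
    have hy: "(h, y) \<in> space (history_space M t)"
      using h y by (simp add: history_space_def space_pair_measure)
    then have "\<pi> t (h, y) \<in> space (prob_algebra ?A)"
      using measurable_space[OF pol] by (simp add: history_space_def)
    then have sets_pi: "sets (\<pi> t (h, y)) = sets ?A" and "prob_space (\<pi> t (h, y))"
      by (simp_all add: space_prob_algebra)
    then interpret prob_space "\<pi> t (h, y)" by simp
    have "prob (feasible M y) = 1"
      using \<pi> hy by (auto simp: policies_def)
    moreover have "feasible M y \<in> events"
      using feasible y by (auto simp: sets_pi space_X)
    ultimately have "AE a in \<pi> t (h, y). a \<in> feasible M y"
      using AE_prob_1 by blast
    then show ?thesis
      by eventually_elim (use y in \<open>auto simp: feasible_pairs_def space_X\<close>)
  qed
  have ret: "(\<lambda>(hy, a). return ?B (snd hy, a)) \<in>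
      ((\<Pi>\<^sub>M i\<in>{0..<t}. pair_space M) \<Otimes>\<^sub>M ?X) \<Otimes>\<^sub>M ?A \<rightarrow>\<^sub>M prob_algebra ?B" for t
    unfolding split_def by (intro measurable_compose[OF _ measurable_return_prob_space]) measurable
  have inner: "(\<lambda>hy. \<pi> t hy \<bind> (\<lambda>a. return ?B (snd hy, a))) \<in>
      (\<Pi>\<^sub>M i\<in>{0..<t}. pair_space M) \<Otimes>\<^sub>M ?X \<rightarrow>\<^sub>M prob_algebra ?B" for t
    by (rule measurable_bind_prob_space2[OF pol ret])
  have joint: "joint t \<in> (\<Pi>\<^sub>M i\<in>{0..<t}. pair_space M) \<rightarrow>\<^sub>M prob_algebra ?B" for t
    unfolding joint_def[abs_def]
    by (rule measurable_bind_prob_space2[OF start]) (use inner in \<open>simp add: split_def\<close>)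
  have joint_F: "AE z in joint t h. z \<in> ?F"
    if h: "h \<in> space (\<Pi>\<^sub>M i\<in>{0..<t}. pair_space M)" for t h
  proof -
    have st: "start t h \<in> space (prob_algebra ?X)"
      using measurable_space[OF start h] .
    then have sets_st: "sets (start t h) = sets ?X" by (simp add: space_prob_algebra)
    have in_F: "Measurable.pred ?B (\<lambda>z. z \<in> ?F)"
      using F by simp
    have m1: "(\<lambda>y. \<pi> t (h, y) \<bind> (\<lambda>a. return ?B (y, a))) \<in> start t h \<rightarrow>\<^sub>M subprob_algebra ?B"
      using measurable_prob_algebraD[OF measurable_compose[OF measurable_Pair1'[OF h] inner]]
      by (simp cong: measurable_cong_sets add: sets_st)
    have m2: "(\<lambda>a. return ?B (y, a)) \<in> \<pi> t (h, y) \<rightarrow>\<^sub>M subprob_algebra ?B" if y: "y \<in> space ?X" for y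
    proof -
      have "(h, y) \<in> space ((\<Pi>\<^sub>M i\<in>{0..<t}. pair_space M) \<Otimes>\<^sub>M ?X)"
        using h y by (simp add: space_pair_measure)
      then have "sets (\<pi> t (h, y)) = sets ?A"
        using measurable_space[OF pol] by (simp add: space_prob_algebra)
      then show ?thesis
        using measurable_compose[OF measurable_Pair1'[OF y] return_measurable]
        by (simp cong: measurable_cong_sets)
    qed
    have "AE a in \<pi> t (h, y). AE z in return ?B (y, a). z \<in> ?F" if y: "y \<in> space ?X" for y
      using pol_F[OF h y]
    proof eventually_elim
      case (elim a)
      then have "(y, a) \<in> space ?B"
        using sets.sets_into_space[OF F(2)] by auto
      with elim show ?case by (simp add: AE_return in_F)
    qed
    then have "AE z in \<pi> t (h, y) \<bind> (\<lambda>a. return ?B (y, a)). z \<in> ?F" if y: "y \<in> space ?X" for y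
      using y by (subst AE_bind[OF m2 in_F]) auto
    moreover have "space (start t h) = space ?X"
      using sets_st by (rule sets_eq_imp_space_eq)
    ultimately show ?thesis
      unfolding joint_def by (subst AE_bind[OF m1 in_F]) auto
  qed
  have step: "step_kernel M \<pi> x t = (\<lambda>h. restrict_space (joint t h) ?F)" for t
    by (simp add: fun_eq_iff step_kernel_def joint_def start_def)
  show ?thesis
  proof (rule Ionescu_Tulcea.intro)
    show "step_kernel M \<pi> x t \<in> (\<Pi>\<^sub>M i\<in>{0..<t}. pair_space M) \<rightarrow>\<^sub>M subprob_algebra (pair_space M)" for t
      unfolding step
      using restrict_space_measurable[OF F measurable_prob_algebraD[OF joint]]
      by (simp add: pair_space_def)
  next
    fix t :: nat and h
    assume h: "h \<in> space (\<Pi>\<^sub>M i\<in>{0..<t}. pair_space M)"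
    have "joint t h \<in> space (prob_algebra ?B)"
      using measurable_space[OF joint h] .
    then have sets_j: "sets (joint t h) = sets ?B" and "prob_space (joint t h)"
      by (simp_all add: space_prob_algebra)
    then interpret prob_space "joint t h" by simp
    have "emeasure (joint t h) ?F = 1"
      using joint_F[OF h] F(2) by (intro emeasure_eq_1_AE) (auto simp: sets_j)
    then have "prob_space (restrict_space (joint t h) ?F)"
      using F(2) by (intro prob_space_restrict_space) (auto simp: sets_j)
    then show "prob_space (step_kernel M \<pi> x t h)"
      by (simp add: step)
  qed
qed

section \<open>Reach-avoid probabilities\<close>

definition hit_target :: "('x, 'a) reach_avoid_data \<Rightarrow> (nat \<Rightarrow> 'x \<times> 'a) \<Rightarrow> enat" where
  "hit_target M \<omega> = (INF t\<in>{t. fst (\<omega> t) \<in> target M}. enat t)"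

definition exit_safe :: "('x, 'a) reach_avoid_data \<Rightarrow> (nat \<Rightarrow> 'x \<times> 'a) \<Rightarrow> enat" where
  "exit_safe M \<omega> = (INF t\<in>{t. fst (\<omega> t) \<in> states M - safe M}. enat t)"

definition reach_prob ::
    "('x::polish_space, 'a::polish_space) reach_avoid_data \<Rightarrow> ('x, 'a) policy \<Rightarrow> 'x \<Rightarrow> real" where
  "reach_prob M \<pi> x =
     measure (path_law M \<pi> x)
       {\<omega> \<in> space (path_law M \<pi> x). hit_target M \<omega> < exit_safe M \<omega> \<and> hit_target M \<omega> < \<infinity>}"

definition optimal_value :: "('x::polish_space, 'a::polish_space) reach_avoid_data \<Rightarrow> 'x \<Rightarrow> real" where
  "optimal_value M x = (SUP \<pi>\<in>policies M. reach_prob M \<pi> x)"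

text \<open>The time \<open>n \<and> \<tau> \<and> \<tau>'\<close>, which is finite.\<close>

definition stopped :: "('x, 'a) reach_avoid_data \<Rightarrow> nat \<Rightarrow> (nat \<Rightarrow> 'x \<times> 'a) \<Rightarrow> nat" where
  "stopped M n \<omega> = the_enat (min (enat n) (min (hit_target M \<omega>) (exit_safe M \<omega>)))"

definition reward :: "('x, 'a) reach_avoid_data \<Rightarrow> nat \<Rightarrow> (nat \<Rightarrow> 'x \<times> 'a) \<Rightarrow> real" where
  "reward M n \<omega> = (\<Sum>t = 0..stopped M (n - 1) \<omega>. indicator (target M) (fst (\<omega> t)))"

definition remaining_value ::
    "('x::polish_space, 'a::polish_space) reach_avoid_data \<Rightarrow> nat \<Rightarrow> (nat \<Rightarrow> 'x \<times> 'a) \<Rightarrow> real" where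
  "remaining_value M n \<omega> =
     indicator (safe M - target M) (fst (\<omega> (stopped M (n - 1) \<omega>))) *
     (indicator (safe M) (fst (\<omega> (stopped M n \<omega>))) * optimal_value M (fst (\<omega> (stopped M n \<omega>))))"

definition zeta ::
    "('x::polish_space, 'a::polish_space) reach_avoid_data \<Rightarrow> 'x \<Rightarrow> nat \<Rightarrow> (nat \<Rightarrow> 'x \<times> 'a) \<Rightarrow> real" where
  "zeta M x n \<omega> = (if n = 0 then optimal_value M x else reward M n \<omega> + remaining_value M n \<omega>)"

definition limit_value ::
    "('x::polish_space, 'a::polish_space) reach_avoid_data \<Rightarrow> ('x, 'a) policy \<Rightarrow> 'x \<Rightarrow> real" where
  "limit_value M \<pi> x = lim (\<lambda>n. \<integral>\<omega>. zeta M x n \<omega> \<partial>path_law M \<pi> x)"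

definition thrifty ::
    "('x::polish_space, 'a::polish_space) reach_avoid_data \<Rightarrow> ('x, 'a) policy \<Rightarrow> 'x \<Rightarrow> bool" where
  "thrifty M \<pi> x \<longleftrightarrow> optimal_value M x = limit_value M \<pi> x"

definition equalizing ::
    "('x::polish_space, 'a::polish_space) reach_avoid_data \<Rightarrow> ('x, 'a) policy \<Rightarrow> 'x \<Rightarrow> bool" where
  "equalizing M \<pi> x \<longleftrightarrow> limit_value M \<pi> x = reach_prob M \<pi> x"

definition optimal_at ::
    "('x::polish_space, 'a::polish_space) reach_avoid_data \<Rightarrow> ('x, 'a) policy \<Rightarrow> 'x \<Rightarrow> bool" where
  "optimal_at M \<pi> x \<longleftrightarrow> reach_prob M \<pi> x = optimal_value M x"

definition strongly_Feller :: "('x::polish_space, 'a::polish_space) reach_avoid_data \<Rightarrow> bool" where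
  "strongly_Feller M \<longleftrightarrow>
     (\<forall>g :: 'x \<Rightarrow> real. g \<in> borel_measurable (state_space M) \<and> bounded (g ` states M) \<longrightarrow>
        continuous_on (live_pairs M) (\<lambda>xa. \<integral>y. g y \<partial>trans_kernel M xa) \<and>
        bounded ((\<lambda>xa. \<integral>y. g y \<partial>trans_kernel M xa) ` live_pairs M))"

end

theory Submission
  imports Defs
begin

text \<open>
  Value iteration \<open>v\<^sub>0 = 1\<^sub>O\<close>, \<open>v\<^sub>n\<^sub>+\<^sub>1 = 1\<^sub>O + 1\<^sub>K\<^sub>-\<^sub>O sup\<^sub>a Q v\<^sub>n\<close> increases to \<open>V\<^sup>\<star>\<close>: no policy reaches the
  target within \<open>n\<close> steps with probability above \<open>v\<^sub>n\<close>, and a deterministic policy made of selectors that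
  are optimal up to a factor \<open>c < 1\<close> at each step attains \<open>c\<^sup>n v\<^sub>n\<close>.  Measurability of \<open>v\<^sub>n\<close> and existence of
  the selectors come from a dense sequence of measurable selectors of \<open>A(\<cdot>)\<close>, because \<open>Q v\<^sub>n\<close> is continuous
  in the action.  Monotone convergence then gives \<open>Q(1\<^sub>K V\<^sup>\<star>) \<le> V\<^sup>\<star>\<close> on \<open>K - O\<close>, so that \<open>E \<zeta>\<^sub>n\<close> is nonincreasing.
  Since \<open>E W\<^sub>n\<close> tends to \<open>V(\<pi>, x)\<close>, one gets \<open>V(\<pi>, x) \<le> \<Lambda>\<^sup>\<pi>(x) \<le> V\<^sup>\<star>(x)\<close>, and the remaining part of \<open>E \<zeta>\<^sub>n\<close>
  tends to \<open>\<Lambda>\<^sup>\<pi>(x) - V(\<pi>, x)\<close>; both claims follow.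
\<close>

section \<open>Measurable selections\<close>

text \<open>Kuratowski and Ryll-Nardzewski: measurable maps with values in a dense sequence come
  within \<open>(1/2)^n\<close> of \<open>\<Psi> x\<close> and form a Cauchy sequence; by
  completeness they converge, and closedness puts the limit in \<open>\<Psi> x\<close>.\<close>

lemma measurable_selector:
  fixes \<Psi> :: "'b \<Rightarrow> 'a::polish_space set"
  assumes closed: "\<And>x. x \<in> space N \<Longrightarrow> closed (\<Psi> x)"
    and nonempty: "\<And>x. x \<in> space N \<Longrightarrow> \<Psi> x \<noteq> {}"
    and hit: "\<And>G. open G \<Longrightarrow> {x \<in> space N. \<Psi> x \<inter> G \<noteq> {}} \<in> sets N"
  shows "\<exists>\<phi> \<in> borel_measurable N. \<forall>x\<in>space N. \<phi> x \<in> \<Psi> x"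
proof -
  obtain D :: "'a set" where D: "countable D" "\<And>U. open U \<Longrightarrow> U \<noteq> {} \<Longrightarrow> \<exists>y\<in>D. y \<in> U"
    using countable_dense_exists by blast
  from D(2)[of UNIV] have "D \<noteq> {}" by auto
  with D(1) obtain d :: "nat \<Rightarrow> 'a" where d: "range d = D"
    by (metis range_from_nat_into)
  have dense: "\<exists>k. d k \<in> U" if "open U" "U \<noteq> {}" for U
    using D(2)[OF that] d by auto
  define Z where "Z n j k x \<longleftrightarrow> \<Psi> x \<inter> (ball (d k) ((1/2)^Suc n) \<inter> ball (d j) ((1/2)^n)) \<noteq> {}" for n j k x
  \<comment> \<open>Taking the least admissible index makes the choice measurable: the conditions
    \<open>Z n j k\<close> only ask whether \<open>\<Psi> x\<close> meets an open set. Intersecting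
    with the previous ball keeps consecutive centres close.\<close>
  define ix where "ix x = rec_nat (LEAST k. \<Psi> x \<inter> ball (d k) 1 \<noteq> {}) (\<lambda>n j. LEAST k. Z n j k x)" for x
  have ix0: "ix x 0 = (LEAST k. \<Psi> x \<inter> ball (d k) 1 \<noteq> {})" for x
    by (simp add: ix_def)
  have ixS: "ix x (Suc n) = (LEAST k. Z n (ix x n) k x)" for x n
    by (simp add: ix_def)
  have mZ: "Measurable.pred N (Z n j k)" for n j k
    unfolding Z_def pred_def by (intro hit open_Int open_ball)
  have m0: "Measurable.pred N (\<lambda>x. \<Psi> x \<inter> ball (d k) 1 \<noteq> {})" for k
    unfolding pred_def by (intro hit open_ball)
  have m_ix: "(\<lambda>x. ix x n) \<in> N \<rightarrow>\<^sub>M count_space UNIV" for n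
  proof (induction n)
    case 0
    show ?case unfolding ix0 by (intro measurable_Least m0)
  next
    case (Suc n)
    have "(\<lambda>x. (\<lambda>j x. LEAST k. Z n j k x) (ix x n) x) \<in> N \<rightarrow>\<^sub>M count_space UNIV"
      by (rule measurable_compose_countable[OF _ Suc]) (intro measurable_Least mZ)
    then show ?case by (simp add: ixS)
  qed
  \<comment> \<open>The link \<open>Z\<close> between consecutive indices is proved together with
    nearness, since nearness at stage \<open>n\<close> provides the existence that the next
    \<open>LEAST\<close> requires.\<close>
  have near': "\<Psi> x \<inter> ball (d (ix x n)) ((1/2)^n) \<noteq> {} \<and> (n > 0 \<longrightarrow> Z (n - 1) (ix x (n - 1)) (ix x n) x)"
      if x: "x \<in> space N" for x n
    proof (induction n)
      case 0
      obtain y where y: "y \<in> \<Psi> x" using nonempty[OF x] by auto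
      obtain k where "d k \<in> ball y 1" using dense[of "ball y 1"] by auto
      with y have "\<Psi> x \<inter> ball (d k) 1 \<noteq> {}" by (auto simp: dist_commute)
      from LeastI[of "\<lambda>k. \<Psi> x \<inter> ball (d k) 1 \<noteq> {}", OF this] show ?case
        by (simp add: ix0)
    next
      case (Suc n)
      then obtain y where y: "y \<in> \<Psi> x" "y \<in> ball (d (ix x n)) ((1/2)^n)" by auto
      have "y \<in> ball y ((1/2)^Suc n)" by simp
      then obtain k where "d k \<in> ball y ((1/2)^Suc n)"
        using dense[OF open_ball] by blast
      with y have "Z n (ix x n) k x" by (auto simp: Z_def dist_commute)
      from LeastI[of "\<lambda>k. Z n (ix x n) k x", OF this] have *: "Z n (ix x n) (ix x (Suc n)) x"
        by (simp add: ixS)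
      then show ?case by (auto simp: Z_def)
    qed
  have near: "\<Psi> x \<inter> ball (d (ix x n)) ((1/2)^n) \<noteq> {}" if "x \<in> space N" for x n
    using near'[OF that] by blast
  have Z: "Z n (ix x n) (ix x (Suc n)) x" if "x \<in> space N" for x n
    using near'[OF that, of "Suc n"] by simp
  define f where "f n x = d (ix x n)" for n x
  have mf: "f n \<in> borel_measurable N" for n
    unfolding f_def[abs_def] by (rule measurable_compose[OF m_ix]) simp
  have step: "dist (f n x) (f (Suc n) x) < 2 * (1/2)^n" if x: "x \<in> space N" for n x
  proof -
    from Z[OF x, of n] obtain y where "dist (f (Suc n) x) y < (1/2)^Suc n" "dist (f n x) y < (1/2)^n"
      by (auto simp: Z_def f_def)
    then have "dist (f n x) (f (Suc n) x) < (1/2)^n + (1/2)^Suc n"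
      using dist_triangle[of "f n x" "f (Suc n) x" y] by (simp add: dist_commute)
    also have "\<dots> \<le> 2 * (1/2)^n" by simp
    finally show ?thesis .
  qed
  have "Cauchy (\<lambda>n. f n x)" if x: "x \<in> space N" for x
  proof (rule metric_CauchyI)
    \<comment> \<open>An increment is below
      \<open>2 * (1/2)^n = 4 * (1/2)^n - 4 * (1/2)^(n+1)\<close>, so the bounds telescope.\<close>
    have tail: "dist (f n x) (f (n + m) x) \<le> 4 * (1/2)^n - 4 * (1/2)^(n + m)" for n m
    proof (induction m)
      case (Suc m)
      have "dist (f n x) (f (n + Suc m) x) \<le> dist (f n x) (f (n + m) x) + dist (f (n + m) x) (f (Suc (n + m)) x)"
        using dist_triangle by simp
      with Suc step[OF x, of "n + m"] show ?case by simp
    qed simp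
    fix e :: real assume "e > 0"
    then obtain K where K: "(1/2)^K < e / 8"
      using real_arch_pow_inv[of "e/8" "1/2"] by auto
    have "dist (f K x) (f m x) < e / 2" if "m \<ge> K" for m
    proof -
      have "dist (f K x) (f m x) \<le> 4 * (1/2)^K - 4 * (1/2)^m"
        using tail[of K "m - K"] that by simp
      moreover have "(0::real) < (1/2)^m" by simp
      ultimately show ?thesis using K by linarith
    qed
    then show "\<exists>K. \<forall>m\<ge>K. \<forall>n\<ge>K. dist (f m x) (f n x) < e"
      by (meson dist_triangle_half_r)
  qed
  then have "\<forall>x\<in>space N. \<exists>l. (\<lambda>n. f n x) \<longlonglongrightarrow> l"
    using Cauchy_convergent by (auto simp: convergent_def)
  then obtain g where g: "\<And>x. x \<in> space N \<Longrightarrow> (\<lambda>n. f n x) \<longlonglongrightarrow> g x"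
    by metis
  have "g \<in> borel_measurable N"
    using mf g by (rule borel_measurable_LIMSEQ_metric)
  moreover have "g x \<in> \<Psi> x" if x: "x \<in> space N" for x
  proof -
    have "\<exists>y. y \<in> \<Psi> x \<and> dist (f n x) y < (1/2)^n" for n
      using near[OF x, of n] by (auto simp: f_def)
    then obtain y where y: "\<And>n. y n \<in> \<Psi> x" "\<And>n. dist (f n x) (y n) < (1/2)^n"
      by metis
    have "y \<longlonglongrightarrow> g x"
    proof (rule tendsto_dist_iff[THEN iffD2, OF tendsto_sandwich[OF _ _ tendsto_const]])
      have "(\<lambda>n. (1/2)^n + dist (f n x) (g x)) \<longlonglongrightarrow> 0 + (0::real)"
        using tendsto_dist_iff[THEN iffD1, OF g[OF x]] by (intro tendsto_add LIMSEQ_realpow_zero) auto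
      then show "(\<lambda>n. (1/2)^n + dist (f n x) (g x)) \<longlonglongrightarrow> 0" by simp
      show "\<forall>\<^sub>F n in sequentially. dist (y n) (g x) \<le> (1/2)^n + dist (f n x) (g x)"
      proof (intro always_eventually allI)
        fix n show "dist (y n) (g x) \<le> (1/2)^n + dist (f n x) (g x)"
          using dist_triangle[of "y n" "g x" "f n x"] y(2)[of n] by (simp add: dist_commute)
      qed
    qed simp
    with y(1) closed[OF x] show ?thesis
      by (meson closed_sequentially)
  qed
  ultimately show ?thesis by blast
qed

text \<open>For each set of a countable base, one measurable selector goes into the closure of that
  set whenever \<open>\<Psi> x\<close> meets it. Base sets shrinking to a point of
  \<open>\<Psi> x\<close> show that these selectors are dense.\<close>

lemma castaing_representation:
  fixes \<Psi> :: "'b \<Rightarrow> 'a::polish_space set"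
  assumes closed: "\<And>x. x \<in> space N \<Longrightarrow> closed (\<Psi> x)"
    and nonempty: "\<And>x. x \<in> space N \<Longrightarrow> \<Psi> x \<noteq> {}"
    and hit: "\<And>G. open G \<Longrightarrow> {x \<in> space N. \<Psi> x \<inter> G \<noteq> {}} \<in> sets N"
  obtains \<phi> :: "nat \<Rightarrow> 'b \<Rightarrow> 'a" where "\<And>k. \<phi> k \<in> borel_measurable N"
    and "\<And>k x. x \<in> space N \<Longrightarrow> \<phi> k x \<in> \<Psi> x"
    and "\<And>x. x \<in> space N \<Longrightarrow> \<Psi> x \<subseteq> closure (range (\<lambda>k. \<phi> k x))"
proof -
  obtain \<B> :: "'a set set" where \<B>: "countable \<B>" "topological_basis \<B>"
    using ex_countable_basis by blast
  have "\<B> \<noteq> {}"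
    using topological_basisE[OF \<B>(2) open_UNIV UNIV_I] by blast
  with \<B>(1) obtain b :: "nat \<Rightarrow> 'a set" where b: "range b = \<B>"
    by (metis range_from_nat_into)
  then have open_b: "open (b k)" for k
    using \<B>(2) by (meson rangeI topological_basis_open)
  have "\<exists>\<phi> \<in> borel_measurable N. \<forall>x\<in>space N. \<phi> x \<in> \<Psi> x \<and> (\<Psi> x \<inter> b k \<noteq> {} \<longrightarrow> \<phi> x \<in> closure (b k))" for k
  proof -
    \<comment> \<open>The closure restores closed values. An open set meets the closure of a set
      exactly when it meets the set itself, so the hitting sets of \<open>\<Phi>\<close> reduce to
      those of \<open>\<Psi>\<close>.\<close>
    define \<Phi> where "\<Phi> x = (if \<Psi> x \<inter> b k \<noteq> {} then closure (\<Psi> x \<inter> b k) else \<Psi> x)" for x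
    have "\<exists>\<phi> \<in> borel_measurable N. \<forall>x\<in>space N. \<phi> x \<in> \<Phi> x"
    proof (rule measurable_selector)
      fix G :: "'a set" assume G: "open G"
      have "{x \<in> space N. \<Phi> x \<inter> G \<noteq> {}} = {x \<in> space N. \<Psi> x \<inter> (b k \<inter> G) \<noteq> {}} \<union>
          ({x \<in> space N. \<Psi> x \<inter> G \<noteq> {}} - {x \<in> space N. \<Psi> x \<inter> b k \<noteq> {}})"
        (is "?L = ?R")
      proof (rule set_eqI)
        fix x
        have "closure (\<Psi> x \<inter> b k) \<inter> G = {} \<longleftrightarrow> \<Psi> x \<inter> (b k \<inter> G) = {}"
          using open_Int_closure_eq_empty[OF G, of "\<Psi> x \<inter> b k"] by (simp add: Int_ac)
        then show "x \<in> ?L \<longleftrightarrow> x \<in> ?R"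
          by (cases "\<Psi> x \<inter> b k = {}") (auto simp: \<Phi>_def)
      qed
      also have "\<dots> \<in> sets N"
        using G open_b by (intro sets.Un sets.Diff hit) auto
      finally show "{x \<in> space N. \<Phi> x \<inter> G \<noteq> {}} \<in> sets N" .
    qed (use closed nonempty in \<open>auto simp: \<Phi>_def\<close>)
    moreover have "\<Phi> x \<subseteq> \<Psi> x" if "x \<in> space N" for x
      using closure_minimal[OF Int_lower1 closed[OF that], of "b k"] by (auto simp: \<Phi>_def)
    moreover have "\<Phi> x \<subseteq> closure (b k)" if "\<Psi> x \<inter> b k \<noteq> {}" for x
      using that closure_mono[of "\<Psi> x \<inter> b k" "b k"] by (auto simp: \<Phi>_def)
    ultimately show ?thesis by (meson subsetD)
  qed
  then obtain \<phi> where m: "\<And>k. \<phi> k \<in> borel_measurable N"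
    and s: "\<And>k x. x \<in> space N \<Longrightarrow> \<phi> k x \<in> \<Psi> x"
    and c: "\<And>k x. x \<in> space N \<Longrightarrow> \<Psi> x \<inter> b k \<noteq> {} \<Longrightarrow> \<phi> k x \<in> closure (b k)"
    by metis
  show ?thesis
  proof (rule that[OF m s])
    fix x assume x: "x \<in> space N"
    show "\<Psi> x \<subseteq> closure (range (\<lambda>k. \<phi> k x))"
    proof
      fix y assume y: "y \<in> \<Psi> x"
      show "y \<in> closure (range (\<lambda>k. \<phi> k x))"
        unfolding closure_approachable
      proof safe
        fix e :: real assume e: "e > 0"
        \<comment> \<open>Half the radius leaves room for passing to the closure: the selector is
          known to lie only in the closure of \<open>b k\<close>.\<close>
        obtain B where B: "B \<in> \<B>" "y \<in> B" "B \<subseteq> ball y (e/2)"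
          using topological_basisE[OF \<B>(2), of "ball y (e/2)" y] e by auto
        then obtain k where k: "B = b k" using b by auto
        have "\<phi> k x \<in> closure (b k)"
          using c[OF x, of k] y B k by auto
        also have "\<dots> \<subseteq> cball y (e/2)"
          using B(3) k by (intro closure_minimal) auto
        finally have "dist (\<phi> k x) y < e"
          using e by (auto simp: dist_commute)
        then show "\<exists>z\<in>range (\<lambda>k. \<phi> k x). dist z y < e" by blast
      qed
    qed
  qed
qed

section \<open>The law of the controlled process\<close>

lemma space_state_space: "space (state_space M) = states M"
  by (simp add: state_space_def space_restrict_space)

lemma space_action_space: "space (action_space M) = actions M"
  by (simp add: action_space_def space_restrict_space)

context reach_avoid
begin

lemma space_pair_space: "space (pair_space M) = feasible_pairs M"
  using sets.sets_into_space[OF feasible_pairs] by (auto simp: pair_space_def space_restrict_space)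

lemma measurable_fst_pair_space[measurable]: "fst \<in> pair_space M \<rightarrow>\<^sub>M state_space M"
  unfolding pair_space_def by (intro measurable_restrict_space1 measurable_fst)

lemma measurable_Pair_pair_space:
  assumes "f \<in> N \<rightarrow>\<^sub>M state_space M" "g \<in> N \<rightarrow>\<^sub>M action_space M"
    and "\<And>w. w \<in> space N \<Longrightarrow> g w \<in> feasible M (f w)"
  shows "(\<lambda>w. (f w, g w)) \<in> N \<rightarrow>\<^sub>M pair_space M"
  unfolding pair_space_def
  using assms(3) measurable_space[OF assms(1)]
  by (intro measurable_restrict_space2 measurable_Pair assms(1,2))
     (auto simp: feasible_pairs_def space_state_space Pi_iff)

text \<open>Functions on feasible pairs have to be integrated against laws on the full product, so
  they are extended by zero.\<close>

lemma measurable_extend_pair_space: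
  fixes g :: "'x \<times> 'a \<Rightarrow> ennreal"
  assumes "g \<in> borel_measurable (pair_space M)"
  shows "(\<lambda>z. g z * indicator (feasible_pairs M) z) \<in> borel_measurable (state_space M \<Otimes>\<^sub>M action_space M)"
  using assms feasible_pairs unfolding pair_space_def
  by (subst (asm) borel_measurable_restrict_space_iff_ennreal) (auto simp: sets.Int_space_eq2)

lemma safe_sets[measurable]: "safe M \<in> sets (state_space M)"
  and target_sets[measurable]: "target M \<in> sets (state_space M)"
  using safe target by auto

text \<open>The kernel \<open>Q\<close> acting on functions. Values in \<open>ennreal\<close> make
  suprema and monotone convergence free of integrability conditions.\<close>

definition expected :: "('x \<Rightarrow> ennreal) \<Rightarrow> 'x \<times> 'a \<Rightarrow> ennreal" where
  "expected u z = (\<integral>\<^sup>+y. u y \<partial>trans_kernel M z)"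

lemma measurable_expected[measurable (raw)]:
  assumes u: "u \<in> borel_measurable (state_space M)"
  shows "expected u \<in> borel_measurable (pair_space M)"
  unfolding expected_def[abs_def]
  by (rule measurable_compose[OF measurable_prob_algebraD[OF kernel] nn_integral_measurable_subprob_algebra[OF u]])

lemma trans_kernel:
  assumes "z \<in> feasible_pairs M"
  shows "prob_space (trans_kernel M z)" "sets (trans_kernel M z) = sets (state_space M)"
    "space (trans_kernel M z) = states M"
proof -
  have "trans_kernel M z \<in> space (prob_algebra (state_space M))"
    using measurable_space[OF kernel] assms by (simp add: space_pair_space)
  then show "prob_space (trans_kernel M z)" and s: "sets (trans_kernel M z) = sets (state_space M)"
    by (simp_all add: space_prob_algebra)
  show "space (trans_kernel M z) = states M"
    using sets_eq_imp_space_eq[OF s] by (simp add: space_state_space)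
qed

lemma expected_mono:
  assumes "z \<in> feasible_pairs M" "\<And>y. y \<in> states M \<Longrightarrow> u y \<le> v y"
  shows "expected u z \<le> expected v z"
  unfolding expected_def using assms by (intro nn_integral_mono) (auto simp: trans_kernel)

lemma expected_le_1:
  assumes "z \<in> feasible_pairs M" "\<And>y. y \<in> states M \<Longrightarrow> u y \<le> 1"
  shows "expected u z \<le> 1"
proof -
  interpret prob_space "trans_kernel M z" using assms(1) by (rule trans_kernel)
  have "expected u z \<le> (\<integral>\<^sup>+y. 1 \<partial>trans_kernel M z)"
    unfolding expected_def using assms by (intro nn_integral_mono) (auto simp: trans_kernel)
  then show ?thesis by (simp add: emeasure_space_1)
qed

lemma measurable_expected_selector:
  assumes "\<phi> \<in> state_space M \<rightarrow>\<^sub>M action_space M" "\<And>y. y \<in> states M \<Longrightarrow> \<phi> y \<in> feasible M y"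
    and "u \<in> borel_measurable (state_space M)"
  shows "(\<lambda>y. expected u (y, \<phi> y)) \<in> borel_measurable (state_space M)"
proof -
  have "(\<lambda>y. (y, \<phi> y)) \<in> state_space M \<rightarrow>\<^sub>M pair_space M"
    using assms by (intro measurable_Pair_pair_space) (auto simp: space_state_space)
  from measurable_compose[OF this measurable_expected[OF assms(3)]] show ?thesis .
qed

end

section \<open>Marginals of the trajectory law under a fixed policy and initial state\<close>

locale controlled = reach_avoid M
  for M :: "('x::polish_space, 'a::polish_space) reach_avoid_data" +
  fixes \<pi> :: "('x, 'a) policy" and x :: 'x
  assumes policy: "\<pi> \<in> policies M" and initial: "x \<in> states M"
begin

sublocale IT: Ionescu_Tulcea "step_kernel M \<pi> x" "\<lambda>_. pair_space M"
  using policy initial by (rule step_kernel_Ionescu_Tulcea)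

abbreviation pathM :: "(nat \<Rightarrow> 'x \<times> 'a) measure" where
  "pathM \<equiv> path_law M \<pi> x"

abbreviation prefix_space :: "nat \<Rightarrow> (nat \<Rightarrow> 'x \<times> 'a) measure" where
  "prefix_space t \<equiv> \<Pi>\<^sub>M i\<in>{0..<t}. pair_space M"

text \<open>The starting point \<open>\<lambda>_. undefined\<close> is the only element of the
  product over the empty index set, that is, the empty history.\<close>

abbreviation prefix_law :: "nat \<Rightarrow> (nat \<Rightarrow> 'x \<times> 'a) measure" where
  "prefix_law t \<equiv> IT.C 0 t (\<lambda>_. undefined)"

lemma path_law_eq: "pathM = IT.PF.lim"
  by (simp add: path_law_def)

lemma sets_path[measurable_cong]: "sets pathM = sets (\<Pi>\<^sub>M i\<in>UNIV. pair_space M)"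
  unfolding path_law_eq by (rule IT.PF.sets_lim)

lemma space_path: "\<omega> \<in> space pathM \<longleftrightarrow> (\<forall>t. \<omega> t \<in> feasible_pairs M)"
  using sets_eq_imp_space_eq[OF sets_path] by (simp add: space_PiM space_pair_space PiE_def Pi_iff)

lemma space_prefix_law: "space (prefix_law t) = space (prefix_space t)"
  using IT.space_C[of "\<lambda>_. undefined" 0 t] by (simp add: space_PiM)

lemma sets_prefix_law[measurable_cong]: "sets (prefix_law t) = sets (prefix_space t)"
  using IT.sets_C[of "\<lambda>_. undefined" 0 t] by (simp add: space_PiM)

text \<open>On an initial segment \<open>IT.CI\<close> coincides with \<open>IT.C\<close>, because
  embedding cylinders from \<open>{0..<t}\<close> into itself changes nothing; the projective limit
  has these laws as marginals.\<close>

lemma distr_prefix: "distr pathM (prefix_space t) (\<lambda>\<omega>. restrict \<omega> {0..<t}) = prefix_law t"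
proof -
  have "IT.CI {0..<t} = prefix_law t"
  proof (rule measure_eqI)
    show s: "sets (IT.CI {0..<t}) = sets (prefix_law t)"
      by (simp add: IT.CI_def sets_prefix_law)
    fix X assume "X \<in> sets (IT.CI {0..<t})"
    then have X: "X \<in> sets (prefix_space t)" by (simp add: s sets_prefix_law)
    then have "prod_emb {0..<t} (\<lambda>_. pair_space M) {0..<t} X = X"
      using sets.sets_into_space[OF X] by (intro prod_emb_id) (auto simp: space_PiM)
    with IT.emeasure_CI[of "{0..<t}" t X] X
    show "emeasure (IT.CI {0..<t}) X = emeasure (prefix_law t) X" by simp
  qed
  then show ?thesis
    using IT.distr_lim[of "{0..<t}"] by (simp add: path_law_eq)
qed

text \<open>A measure is a probability as soon as one of its images is; the marginal on the empty
  history serves.\<close>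

lemma prob_space_path: "prob_space pathM"
proof (rule prob_space_distrD)
  show "prob_space (distr pathM (prefix_space 0) (\<lambda>\<omega>. restrict \<omega> {0..<0}))"
    unfolding distr_prefix by (rule IT.prob_space_C) (simp add: space_PiM)
qed measurable

lemma nn_integral_prefix:
  assumes f: "f \<in> borel_measurable (prefix_space t)"
  shows "(\<integral>\<^sup>+\<omega>. f (restrict \<omega> {0..<t}) \<partial>pathM) = (\<integral>\<^sup>+h. f h \<partial>prefix_law t)"
  unfolding distr_prefix[symmetric] by (subst nn_integral_distr) (use f in auto)

text \<open>Disintegration: the law of \<open>t + 1\<close> pairs is the law of \<open>t\<close>
  pairs composed with the step kernel, which appends coordinate \<open>t\<close>.\<close>

lemma nn_integral_prefix_Suc:
  assumes f[measurable]: "f \<in> borel_measurable (prefix_space (Suc t))"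
  shows "(\<integral>\<^sup>+h. f h \<partial>prefix_law (Suc t)) =
    (\<integral>\<^sup>+h. (\<integral>\<^sup>+z. f (h(t := z)) \<partial>step_kernel M \<pi> x t h) \<partial>prefix_law t)"
proof -
  have e: "IT.eP t \<in> prefix_law t \<rightarrow>\<^sub>M subprob_algebra (prefix_space (Suc t))"
    using IT.measurable_eP[of t] by (simp cong: measurable_cong_sets add: sets_prefix_law)
  show ?thesis
    by (simp add: nn_integral_bind[OF f e], intro nn_integral_cong)
       (simp add: space_prefix_law IT.nn_integral_eP[OF _ f])
qed

text \<open>The conditional law of the state at time \<open>t\<close> given the earlier pairs,
  before the policy acts; it is the first stage of \<open>step_kernel\<close>.\<close>

definition state_law :: "nat \<Rightarrow> (nat \<Rightarrow> 'x \<times> 'a) \<Rightarrow> 'x measure" where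
  "state_law t h = (case t of 0 \<Rightarrow> return (state_space M) x | Suc s \<Rightarrow> trans_kernel M (h s))"

lemma state_law_prob_algebra:
  assumes h: "h \<in> space (prefix_space t)"
  shows "state_law t h \<in> space (prob_algebra (state_space M))"
proof (cases t)
  case 0
  then show ?thesis
    using initial by (simp add: state_law_def space_prob_algebra prob_space_return space_state_space)
next
  case (Suc s)
  then have "h s \<in> space (pair_space M)"
    using h by (auto simp: space_PiM PiE_iff)
  then show ?thesis
    using measurable_space[OF kernel] Suc by (simp add: state_law_def)
qed

lemma policy_prob_algebra:
  assumes h: "h \<in> space (prefix_space t)" and y: "y \<in> states M"
  shows "\<pi> t (h, y) \<in> space (prob_algebra (action_space M))"
    and "AE a in \<pi> t (h, y). (y, a) \<in> feasible_pairs M"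
proof -
  have hy: "(h, y) \<in> space (history_space M t)"
    using h y by (simp add: history_space_def space_pair_measure space_state_space)
  then show *: "\<pi> t (h, y) \<in> space (prob_algebra (action_space M))"
    using policy by (auto simp: policies_def dest: measurable_space)
  interpret prob_space "\<pi> t (h, y)" using * by (simp add: space_prob_algebra)
  have "prob (feasible M y) = 1"
    using policy hy by (auto simp: policies_def)
  moreover have "feasible M y \<in> events"
    using feasible y * by (auto simp: space_prob_algebra)
  ultimately have "AE a in \<pi> t (h, y). a \<in> feasible M y"
    using AE_prob_1 by blast
  then show "AE a in \<pi> t (h, y). (y, a) \<in> feasible_pairs M"
    using y by (auto simp: feasible_pairs_def)
qed

text \<open>Draw the state, then the action. The indicator compensates for \<open>g\<close> being
  measurable only on feasible pairs, where \<open>step_kernel\<close> lives.\<close>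

lemma nn_integral_step_kernel:
  assumes h: "h \<in> space (prefix_space t)" and g: "g \<in> borel_measurable (pair_space M)"
  shows "(\<integral>\<^sup>+z. g z \<partial>step_kernel M \<pi> x t h) =
    (\<integral>\<^sup>+y. (\<integral>\<^sup>+a. g (y, a) * indicator (feasible_pairs M) (y, a) \<partial>\<pi> t (h, y)) \<partial>state_law t h)"
proof -
  let ?X = "state_space M" and ?A = "action_space M" and ?F = "feasible_pairs M"
  let ?B = "?X \<Otimes>\<^sub>M ?A"
  define J where "J = state_law t h \<bind> (\<lambda>y. \<pi> t (h, y) \<bind> (\<lambda>a. return ?B (y, a)))"
  have gF[measurable]: "(\<lambda>z. g z * indicator ?F z) \<in> borel_measurable ?B"
    using g by (rule measurable_extend_pair_space)
  have sets_st: "sets (state_law t h) = sets ?X"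
    using state_law_prob_algebra[OF h] by (simp add: space_prob_algebra)
  then have space_st: "space (state_law t h) = states M"
    by (metis sets_eq_imp_space_eq space_state_space)
  have pol: "\<pi> t \<in> prefix_space t \<Otimes>\<^sub>M ?X \<rightarrow>\<^sub>M prob_algebra ?A"
    using policy by (simp add: policies_def history_space_def)
  have ret: "(\<lambda>(hy, a). return ?B (snd hy, a)) \<in>
      (prefix_space t \<Otimes>\<^sub>M ?X) \<Otimes>\<^sub>M ?A \<rightarrow>\<^sub>M prob_algebra ?B"
    unfolding split_def by (intro measurable_compose[OF _ measurable_return_prob_space]) measurable
  have inner: "(\<lambda>hy. \<pi> t hy \<bind> (\<lambda>a. return ?B (snd hy, a))) \<in>
      prefix_space t \<Otimes>\<^sub>M ?X \<rightarrow>\<^sub>M prob_algebra ?B"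
    by (rule measurable_bind_prob_space2[OF pol ret])
  have m1: "(\<lambda>y. \<pi> t (h, y) \<bind> (\<lambda>a. return ?B (y, a))) \<in> state_law t h \<rightarrow>\<^sub>M subprob_algebra ?B"
    using measurable_prob_algebraD[OF measurable_compose[OF measurable_Pair1'[OF h] inner]]
    by (simp cong: measurable_cong_sets add: sets_st)
  \<comment> \<open>The sigma-algebra of a bind is determined only over a nonempty space; the
    initial state is the witness.\<close>
  have sets_J: "sets J = sets ?B"
    unfolding J_def using initial by (intro sets_bind sets_kernel[OF m1]) (auto simp: space_st)
  have "step_kernel M \<pi> x t h = restrict_space J ?F"
    by (simp add: step_kernel_def J_def state_law_def)
  then have "(\<integral>\<^sup>+z. g z \<partial>step_kernel M \<pi> x t h) = (\<integral>\<^sup>+z. g z * indicator ?F z \<partial>J)"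
    using feasible_pairs by (simp add: nn_integral_restrict_space sets_J sets.Int_space_eq2)
  also have "\<dots> = (\<integral>\<^sup>+y. (\<integral>\<^sup>+z. g z * indicator ?F z \<partial>(\<pi> t (h, y) \<bind> (\<lambda>a. return ?B (y, a)))) \<partial>state_law t h)"
    unfolding J_def by (rule nn_integral_bind[OF gF m1])
  also have "\<dots> = (\<integral>\<^sup>+y. (\<integral>\<^sup>+a. g (y, a) * indicator ?F (y, a) \<partial>\<pi> t (h, y)) \<partial>state_law t h)"
  proof (rule nn_integral_cong)
    fix y assume "y \<in> space (state_law t h)"
    then have y: "y \<in> states M" "y \<in> space ?X" by (simp_all add: space_st space_state_space)
    have sets_pi: "sets (\<pi> t (h, y)) = sets ?A"
      using policy_prob_algebra(1)[OF h y(1)] by (simp add: space_prob_algebra)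
    then have space_pi: "space (\<pi> t (h, y)) = space ?A" by (rule sets_eq_imp_space_eq)
    have m2: "(\<lambda>a. return ?B (y, a)) \<in> \<pi> t (h, y) \<rightarrow>\<^sub>M subprob_algebra ?B"
      using measurable_compose[OF measurable_Pair1'[OF y(2)] return_measurable] sets_pi
      by (simp cong: measurable_cong_sets)
    show "(\<integral>\<^sup>+z. g z * indicator ?F z \<partial>(\<pi> t (h, y) \<bind> (\<lambda>a. return ?B (y, a)))) =
        (\<integral>\<^sup>+a. g (y, a) * indicator ?F (y, a) \<partial>\<pi> t (h, y))"
      unfolding nn_integral_bind[OF gF m2]
      using y by (intro nn_integral_cong nn_integral_return gF) (auto simp: space_pi space_pair_measure)
  qed
  finally show ?thesis .
qed

text \<open>For a function of the state alone the action integrates out, since the policy gives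
  feasible actions mass 1.\<close>

lemma nn_integral_step_kernel_fst:
  assumes h: "h \<in> space (prefix_space t)" and u: "u \<in> borel_measurable (state_space M)"
  shows "(\<integral>\<^sup>+z. u (fst z) \<partial>step_kernel M \<pi> x t h) = (\<integral>\<^sup>+y. u y \<partial>state_law t h)"
proof -
  have "(\<integral>\<^sup>+a. u y * indicator (feasible_pairs M) (y, a) \<partial>\<pi> t (h, y)) = u y" if y: "y \<in> states M" for y
  proof -
    interpret prob_space "\<pi> t (h, y)"
      using policy_prob_algebra(1)[OF h y] by (simp add: space_prob_algebra)
    have "(\<integral>\<^sup>+a. u y * indicator (feasible_pairs M) (y, a) \<partial>\<pi> t (h, y)) = (\<integral>\<^sup>+a. u y \<partial>\<pi> t (h, y))"
      using policy_prob_algebra(2)[OF h y] by (intro nn_integral_cong_AE) auto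
    then show ?thesis by (simp add: emeasure_space_1)
  qed
  moreover have "space (state_law t h) = states M"
    using state_law_prob_algebra[OF h]
    by (metis (mono_tags, lifting) sets_eq_imp_space_eq space_state_space space_prob_algebra mem_Collect_eq)
  moreover have "(\<lambda>z. u (fst z)) \<in> borel_measurable (pair_space M)"
    using u by measurable
  ultimately show ?thesis
    by (simp add: nn_integral_step_kernel[OF h]) (intro nn_integral_cong, simp)
qed

end

section \<open>Killing times expressed through \<open>alive\<close>\<close>

definition alive :: "('x, 'a) reach_avoid_data \<Rightarrow> nat \<Rightarrow> (nat \<Rightarrow> 'x \<times> 'a) \<Rightarrow> bool" where
  "alive M t \<omega> \<longleftrightarrow> (\<forall>s<t. fst (\<omega> s) \<in> safe M - target M)"

lemma alive_0[simp]: "alive M 0 \<omega>"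
  by (simp add: alive_def)

lemma alive_Suc: "alive M (Suc t) \<omega> \<longleftrightarrow> alive M t \<omega> \<and> fst (\<omega> t) \<in> safe M - target M"
  by (auto simp: alive_def less_Suc_eq)

text \<open>The inequality in \<open>alive\<close> is strict: the state at time \<open>t\<close> is
  unrestricted, and the event is decided by the prefix of length \<open>t\<close>.\<close>

lemma alive_cong: "(\<And>s. s < t \<Longrightarrow> \<omega> s = \<omega>' s) \<Longrightarrow> alive M t \<omega> = alive M t \<omega>'"
  by (simp add: alive_def)

context reach_avoid
begin

lemma feasible_pairs_fst: "z \<in> feasible_pairs M \<Longrightarrow> fst z \<in> states M"
  by (auto simp: feasible_pairs_def)

lemma safe_subset: "safe M \<subseteq> states M" and target_subset: "target M \<subseteq> safe M"
  using safe sets.sets_into_space[OF safe(1)] by (auto simp: space_state_space)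

text \<open>The witness is the first hitting time of the target; before it the path has neither hit
  the target nor left the safe set.\<close>

lemma hit_before_exit_iff:
  assumes \<omega>: "\<forall>t. \<omega> t \<in> feasible_pairs M"
  shows "hit_target M \<omega> < exit_safe M \<omega> \<and> hit_target M \<omega> < \<infinity> \<longleftrightarrow>
    (\<exists>t. alive M t \<omega> \<and> fst (\<omega> t) \<in> target M)"
proof safe
  assume less: "hit_target M \<omega> < exit_safe M \<omega>" and fin: "hit_target M \<omega> < \<infinity>"
  have "\<exists>t. fst (\<omega> t) \<in> target M"
  proof (rule ccontr)
    assume "\<not> ?thesis"
    then have "{t. fst (\<omega> t) \<in> target M} = {}" by simp
    then have "hit_target M \<omega> = \<infinity>"
      by (simp only: hit_target_def image_empty Inf_empty top_enat_def)
    with fin show False by simp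
  qed
  define t where "t = (LEAST t. fst (\<omega> t) \<in> target M)"
  have "fst (\<omega> t) \<in> target M"
    unfolding t_def by (rule LeastI_ex) fact
  moreover have "hit_target M \<omega> = enat t"
    unfolding hit_target_def
  proof (intro antisym INF_greatest)
    show "(INF t\<in>{t. fst (\<omega> t) \<in> target M}. enat t) \<le> enat t"
      using \<open>fst (\<omega> t) \<in> target M\<close> by (intro INF_lower) simp
  qed (simp add: t_def Least_le)
  ultimately have t: "fst (\<omega> t) \<in> target M" "hit_target M \<omega> = enat t" .
  have "fst (\<omega> s) \<in> safe M - target M" if "s < t" for s
  proof -
    have "fst (\<omega> s) \<notin> target M"
      using that t(2) unfolding hit_target_def
      by (metis (mono_tags, lifting) INF_lower enat_ord_simps(1) leD mem_Collect_eq)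
    moreover have "fst (\<omega> s) \<notin> states M - safe M"
    proof
      assume "fst (\<omega> s) \<in> states M - safe M"
      then have "exit_safe M \<omega> \<le> enat s"
        unfolding exit_safe_def by (intro INF_lower) auto
      with less t(2) that show False
        by (metis enat_ord_simps(2) leD less_trans)
    qed
    ultimately show ?thesis
      using feasible_pairs_fst[OF \<omega>[rule_format, of s]] by auto
  qed
  with t show "\<exists>t. alive M t \<omega> \<and> fst (\<omega> t) \<in> target M"
    by (auto simp: alive_def)
next
  fix t assume t: "alive M t \<omega>" "fst (\<omega> t) \<in> target M"
  have 1: "hit_target M \<omega> \<le> enat t"
    unfolding hit_target_def using t by (intro INF_lower) auto
  \<comment> \<open>Time \<open>t\<close> itself is no exit time, as the target lies in the safe
    set. This gains the extra unit that makes the final inequality strict.\<close>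
  have "enat (Suc t) \<le> exit_safe M \<omega>"
    unfolding exit_safe_def
  proof (rule INF_greatest)
    fix s assume "s \<in> {s. fst (\<omega> s) \<in> states M - safe M}"
    then have "fst (\<omega> s) \<notin> safe M" by auto
    then have "\<not> s \<le> t"
      using t target_subset by (auto simp: alive_def le_less)
    then show "enat (Suc t) \<le> enat s" by simp
  qed
  with 1 show "hit_target M \<omega> < exit_safe M \<omega>"
    by (metis enat_ord_simps(2) lessI order_le_less_trans order_less_le_trans)
  show "hit_target M \<omega> < \<infinity>"
    using 1 by (metis enat_ord_simps(4) infinity_ileE not_le_imp_less order_le_less_trans)
qed

text \<open>On feasible paths \<open>alive M t\<close> means
  \<open>t \<le> \<tau> \<and> \<tau>'\<close>. Lower bounds turn the minimum of infima into a
  conjunction, so no case split on infinite times arises.\<close>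

lemma le_stopped_iff:
  assumes \<omega>: "\<forall>t. \<omega> t \<in> feasible_pairs M"
  shows "t \<le> stopped M n \<omega> \<longleftrightarrow> t \<le> n \<and> alive M t \<omega>"
proof -
  let ?m = "min (enat n) (min (hit_target M \<omega>) (exit_safe M \<omega>))"
  have "?m \<le> enat n" by simp
  then obtain k where k: "?m = enat k" by (metis enat_ile)
  have "t \<le> stopped M n \<omega> \<longleftrightarrow> enat t \<le> ?m"
    unfolding stopped_def k by simp
  also have "\<dots> \<longleftrightarrow> t \<le> n \<and> enat t \<le> hit_target M \<omega> \<and> enat t \<le> exit_safe M \<omega>"
    by simp
  also have "\<dots> \<longleftrightarrow> t \<le> n \<and> (\<forall>s. fst (\<omega> s) \<in> target M \<or> fst (\<omega> s) \<in> states M - safe M \<longrightarrow> t \<le> s)"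
    unfolding hit_target_def exit_safe_def le_INF_iff by auto
  also have "\<dots> \<longleftrightarrow> t \<le> n \<and> alive M t \<omega>"
    using feasible_pairs_fst[OF \<omega>[rule_format]] unfolding alive_def by (meson DiffD1 DiffD2 DiffI leD leI)
  finally show ?thesis .
qed

lemma reward_eq:
  assumes \<omega>: "\<forall>t. \<omega> t \<in> feasible_pairs M"
  shows "reward M (Suc n) \<omega> = (\<Sum>t<Suc n. if alive M t \<omega> then indicator (target M) (fst (\<omega> t)) else 0)"
proof -
  have "{0..stopped M n \<omega>} = {t \<in> {..<Suc n}. alive M t \<omega>}"
    using le_stopped_iff[OF \<omega>] by auto
  then show ?thesis
    by (simp only: reward_def diff_Suc_1 sum.inter_filter[OF finite_lessThan])
qed

text \<open>A living path is stopped at neither \<open>n\<close> nor \<open>Suc n\<close>, so both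
  stopped times are the plain ones; for a killed path the first indicator vanishes.\<close>

lemma remaining_value_eq:
  assumes \<omega>: "\<forall>t. \<omega> t \<in> feasible_pairs M"
  shows "remaining_value M (Suc n) \<omega> =
    (if alive M (Suc n) \<omega> then indicator (safe M) (fst (\<omega> (Suc n))) * optimal_value M (fst (\<omega> (Suc n))) else 0)"
proof (cases "alive M (Suc n) \<omega>")
  case True
  then have "alive M n \<omega>" by (simp add: alive_Suc)
  with True have "n \<le> stopped M n \<omega>" "Suc n \<le> stopped M (Suc n) \<omega>"
    using le_stopped_iff[OF \<omega>] by auto
  moreover have "stopped M n \<omega> \<le> n" "stopped M (Suc n) \<omega> \<le> Suc n"
    using le_stopped_iff[OF \<omega>, of "stopped M n \<omega>" n]
      le_stopped_iff[OF \<omega>, of "stopped M (Suc n) \<omega>" "Suc n"] by simp_all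
  ultimately have "stopped M n \<omega> = n" "stopped M (Suc n) \<omega> = Suc n" by auto
  then show ?thesis
    using True by (simp add: remaining_value_def alive_Suc)
next
  case False
  \<comment> \<open>The stopped time is the largest \<open>s \<le> n\<close> with
    \<open>alive M s\<close>. Were the state at \<open>s\<close> still in
    \<open>safe M - target M\<close>, the path would be alive at \<open>Suc s\<close>, against
    maximality if \<open>s < n\<close> and against the case assumption if
    \<open>s = n\<close>.\<close>
  define s where "s = stopped M n \<omega>"
  have s: "s \<le> n" "alive M s \<omega>" and "\<not> Suc s \<le> stopped M n \<omega>"
    using le_stopped_iff[OF \<omega>, of s n] by (auto simp: s_def)
  then have "\<not> (Suc s \<le> n \<and> alive M (Suc s) \<omega>)"
    using le_stopped_iff[OF \<omega>, of "Suc s" n] by simp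
  with False s have "fst (\<omega> s) \<notin> safe M - target M"
    by (metis Suc_leI alive_Suc le_neq_implies_less)
  then show ?thesis
    using False by (auto simp: remaining_value_def s_def[symmetric])
qed

end

section \<open>Expectations over paths that are not yet killed\<close>

context controlled
begin

text \<open>The measure is left general so that the fact serves both path space and prefix
  spaces.\<close>

lemma pred_alive:
  assumes "\<And>s. s < t \<Longrightarrow> (\<lambda>\<omega>. \<omega> s) \<in> N \<rightarrow>\<^sub>M pair_space M"
  shows "Measurable.pred N (alive M t)"
proof -
  have "Measurable.pred N (\<lambda>\<omega>. \<forall>s\<in>{..<t}. fst (\<omega> s) \<in> safe M - target M)"
  proof (intro pred_intros_finite)
    fix s assume "s \<in> {..<t}"
    then have [measurable]: "(\<lambda>\<omega>. \<omega> s) \<in> N \<rightarrow>\<^sub>M pair_space M" using assms by simp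
    show "Measurable.pred N (\<lambda>\<omega>. fst (\<omega> s) \<in> safe M - target M)" by measurable
  qed simp
  moreover have "alive M t = (\<lambda>\<omega>. \<forall>s\<in>{..<t}. fst (\<omega> s) \<in> safe M - target M)"
    by (auto simp: alive_def fun_eq_iff)
  ultimately show ?thesis by (simp only:)
qed

lemma pred_alive_path[measurable]: "Measurable.pred pathM (alive M t)"
  by (rule pred_alive) measurable

text \<open>The expectation of \<open>g(x_t, a_t)\<close> on the event
  \<open>t \<le> \<tau> \<and> \<tau>'\<close>.\<close>

definition live_int :: "nat \<Rightarrow> ('x \<times> 'a \<Rightarrow> ennreal) \<Rightarrow> ennreal" where
  "live_int t g = (\<integral>\<^sup>+\<omega>. (if alive M t \<omega> then g (\<omega> t) else 0) \<partial>pathM)"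

lemma live_int_mono:
  assumes "\<And>z. z \<in> feasible_pairs M \<Longrightarrow> g z \<le> g' z"
  shows "live_int t g \<le> live_int t g'"
  unfolding live_int_def using assms by (intro nn_integral_mono) (auto simp: space_path)

lemma live_int_add:
  assumes [measurable]: "g \<in> borel_measurable (pair_space M)" "g' \<in> borel_measurable (pair_space M)"
  shows "live_int t (\<lambda>z. g z + g' z) = live_int t g + live_int t g'"
  unfolding live_int_def by (subst nn_integral_add[symmetric]) (auto intro!: nn_integral_cong)

lemma live_int_cmult:
  assumes [measurable]: "g \<in> borel_measurable (pair_space M)"
  shows "live_int t (\<lambda>z. c * g z) = c * live_int t g"
  unfolding live_int_def by (subst nn_integral_cmult[symmetric]) (auto intro!: nn_integral_cong)

lemma live_int_le_1:
  assumes "\<And>z. z \<in> feasible_pairs M \<Longrightarrow> g z \<le> 1"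
  shows "live_int t g \<le> 1"
proof -
  interpret prob_space pathM by (rule prob_space_path)
  have "live_int t g \<le> (\<integral>\<^sup>+\<omega>. 1 \<partial>pathM)"
    unfolding live_int_def using assms by (intro nn_integral_mono) (auto simp: space_path)
  then show ?thesis by (simp add: emeasure_space_1)
qed

text \<open>Being alive at \<open>t\<close> depends on earlier coordinates only, so conditioning on
  the prefix leaves the step kernel to integrate \<open>g\<close>.\<close>

lemma live_int_step:
  assumes g[measurable]: "g \<in> borel_measurable (pair_space M)"
  shows "live_int t g = (\<integral>\<^sup>+h. (if alive M t h then \<integral>\<^sup>+z. g z \<partial>step_kernel M \<pi> x t h else 0) \<partial>prefix_law t)"
proof -
  let ?f = "\<lambda>h. if alive M t h then g (h t) else 0"
  have [measurable]: "Measurable.pred (prefix_space (Suc t)) (alive M t)"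
    by (rule pred_alive) (auto intro: measurable_component_singleton)
  have [measurable]: "(\<lambda>h. h t) \<in> prefix_space (Suc t) \<rightarrow>\<^sub>M pair_space M"
    by (rule measurable_component_singleton) simp
  have f: "?f \<in> borel_measurable (prefix_space (Suc t))"
    by measurable
  have "live_int t g = (\<integral>\<^sup>+\<omega>. ?f (restrict \<omega> {0..<Suc t}) \<partial>pathM)"
    unfolding live_int_def by (intro nn_integral_cong if_cong alive_cong) auto
  also have "\<dots> = (\<integral>\<^sup>+h. (\<integral>\<^sup>+z. ?f (h(t := z)) \<partial>step_kernel M \<pi> x t h) \<partial>prefix_law t)"
    by (simp only: nn_integral_prefix[OF f] nn_integral_prefix_Suc[OF f])
  also have "\<dots> = (\<integral>\<^sup>+h. (if alive M t h then \<integral>\<^sup>+z. g z \<partial>step_kernel M \<pi> x t h else 0) \<partial>prefix_law t)"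
  proof (rule nn_integral_cong)
    fix h :: "nat \<Rightarrow> 'x \<times> 'a"
    have "alive M t (h(t := z)) = alive M t h" for z
      by (rule alive_cong) auto
    then show "(\<integral>\<^sup>+z. ?f (h(t := z)) \<partial>step_kernel M \<pi> x t h) =
        (if alive M t h then \<integral>\<^sup>+z. g z \<partial>step_kernel M \<pi> x t h else 0)"
      by simp
  qed
  finally show ?thesis .
qed

lemma live_int_0:
  assumes u: "u \<in> borel_measurable (state_space M)"
  shows "live_int 0 (\<lambda>z. u (fst z)) = u x"
proof -
  have "(\<integral>\<^sup>+z. u (fst z) \<partial>step_kernel M \<pi> x 0 (\<lambda>_. undefined)) = u x"
    using u initial
    by (simp add: nn_integral_step_kernel_fst space_PiM state_law_def nn_integral_return space_state_space)
  moreover have "live_int 0 (\<lambda>z. u (fst z)) = (\<integral>\<^sup>+h. (\<integral>\<^sup>+z. u (fst z) \<partial>step_kernel M \<pi> x 0 h) \<partial>prefix_law 0)"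
    using u by (subst live_int_step) auto
  moreover have "\<dots> = (\<integral>\<^sup>+z. u (fst z) \<partial>step_kernel M \<pi> x 0 (\<lambda>_. undefined))"
    \<comment> \<open>The prefix law at time 0 is the point mass at the empty history.\<close>
    unfolding IT.C.simps
  proof (rule nn_integral_return)
    show "(\<lambda>h. \<integral>\<^sup>+z. u (fst z) \<partial>step_kernel M \<pi> x 0 h) \<in> borel_measurable (prefix_space 0)"
      by (intro measurable_compose[OF IT.P nn_integral_measurable_subprob_algebra]
          measurable_compose[OF measurable_fst_pair_space u])
  qed (simp add: space_PiM)
  ultimately show ?thesis by simp
qed

text \<open>Given the past, the next state has law \<open>Q\<close> at the current pair whatever the
  policy does next. Survival to \<open>Suc t\<close> adds the condition on the state at
  \<open>t\<close>.\<close>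

lemma live_int_Suc:
  assumes u[measurable]: "u \<in> borel_measurable (state_space M)"
  shows "live_int (Suc t) (\<lambda>z. u (fst z)) =
    live_int t (\<lambda>z. if fst z \<in> safe M - target M then expected u z else 0)"
proof -
  have [measurable]: "Measurable.pred (prefix_space (Suc t)) (alive M (Suc t))"
    by (rule pred_alive) (auto intro: measurable_component_singleton)
  have [measurable]: "(\<lambda>h. h t) \<in> prefix_space (Suc t) \<rightarrow>\<^sub>M pair_space M"
    by (rule measurable_component_singleton) simp
  let ?f = "\<lambda>h. if alive M (Suc t) h then expected u (h t) else 0"
  have [measurable]: "(\<lambda>h. expected u (h t)) \<in> borel_measurable (prefix_space (Suc t))"
    by (rule measurable_compose[OF _ measurable_expected[OF u]]) measurable
  have f: "?f \<in> borel_measurable (prefix_space (Suc t))"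
    by measurable
  have "live_int (Suc t) (\<lambda>z. u (fst z)) = (\<integral>\<^sup>+h. ?f h \<partial>prefix_law (Suc t))"
    by (subst live_int_step, simp)
       (intro nn_integral_cong, simp add: space_prefix_law nn_integral_step_kernel_fst state_law_def expected_def
         del: IT.C.simps)
  also have "\<dots> = (\<integral>\<^sup>+\<omega>. ?f (restrict \<omega> {0..<Suc t}) \<partial>pathM)"
    by (simp only: nn_integral_prefix[OF f])
  also have "\<dots> = live_int t (\<lambda>z. if fst z \<in> safe M - target M then expected u z else 0)"
    unfolding live_int_def
  proof (intro nn_integral_cong)
    fix \<omega> :: "nat \<Rightarrow> 'x \<times> 'a"
    have "alive M (Suc t) (restrict \<omega> {0..<Suc t}) = alive M (Suc t) \<omega>"
      by (rule alive_cong) simp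
    then show "?f (restrict \<omega> {0..<Suc t}) =
        (if alive M t \<omega> then if fst (\<omega> t) \<in> safe M - target M then expected u (\<omega> t) else 0 else 0)"
      by (simp add: alive_Suc)
  qed
  finally show ?thesis .
qed

text \<open>The action at time \<open>t\<close> is almost surely \<open>\<phi>\<close> of the state,
  whatever the history, so it may be substituted into \<open>g\<close>.\<close>

lemma live_int_deterministic:
  assumes \<phi>[measurable]: "\<phi> \<in> state_space M \<rightarrow>\<^sub>M action_space M"
    and feas: "\<And>y. y \<in> states M \<Longrightarrow> \<phi> y \<in> feasible M y"
    and det: "\<And>h y. \<pi> t (h, y) = return (action_space M) (\<phi> y)"
    and g: "g \<in> borel_measurable (pair_space M)"
  shows "live_int t g = live_int t (\<lambda>z. g (fst z, \<phi> (fst z)))"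
proof -
  have det_int: "(\<integral>\<^sup>+z. g z \<partial>step_kernel M \<pi> x t h) = (\<integral>\<^sup>+y. g (y, \<phi> y) \<partial>state_law t h)"
    if g: "g \<in> borel_measurable (pair_space M)" and h: "h \<in> space (prefix_space t)" for g h
    unfolding nn_integral_step_kernel[OF h g]
  proof (rule nn_integral_cong)
    fix y assume "y \<in> space (state_law t h)"
    then have y: "y \<in> states M" "y \<in> space (state_space M)"
      using state_law_prob_algebra[OF h] sets_eq_imp_space_eq[of "state_law t h" "state_space M"]
      by (auto simp: space_prob_algebra space_state_space)
    from measurable_compose[OF measurable_Pair1'[OF y(2)] measurable_extend_pair_space[OF g]]
    have m: "(\<lambda>a. g (y, a) * indicator (feasible_pairs M) (y, a)) \<in> borel_measurable (action_space M)" .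
    have "\<phi> y \<in> space (action_space M)" using measurable_space[OF \<phi> y(2)] .
    then show "(\<integral>\<^sup>+a. g (y, a) * indicator (feasible_pairs M) (y, a) \<partial>\<pi> t (h, y)) = g (y, \<phi> y)"
      unfolding det using feas y m by (subst nn_integral_return) (auto simp: feasible_pairs_def)
  qed
  have m: "(\<lambda>z. (fst z, \<phi> (fst z))) \<in> pair_space M \<rightarrow>\<^sub>M pair_space M"
    using feas by (intro measurable_Pair_pair_space) (auto simp: space_pair_space feasible_pairs_def)
  have g': "(\<lambda>z. g (fst z, \<phi> (fst z))) \<in> borel_measurable (pair_space M)"
    by (rule measurable_compose[OF m g])
  show ?thesis
    unfolding live_int_step[OF g] live_int_step[OF g']
    by (intro nn_integral_cong) (simp add: space_prefix_law det_int[OF g] det_int[OF g'])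
qed

text \<open>The probability that \<open>\<tau> = t < \<tau>'\<close>.\<close>

definition hit_prob :: "nat \<Rightarrow> ennreal" where
  "hit_prob t = live_int t (\<lambda>z. indicator (target M) (fst z))"

text \<open>The success event is split according to the time of the first hit; these events are
  disjoint because an earlier hit kills the path.\<close>

lemma reach_prob_eq_suminf: "ennreal (reach_prob M \<pi> x) = (\<Sum>t. hit_prob t)"
proof -
  interpret prob_space pathM by (rule prob_space_path)
  let ?E = "\<lambda>t. {\<omega> \<in> space pathM. alive M t \<omega> \<and> fst (\<omega> t) \<in> target M}"
  have E: "?E t \<in> events" for t by measurable
  have "hit_prob t = emeasure pathM (?E t)" for t
  proof -
    have "hit_prob t = (\<integral>\<^sup>+\<omega>. indicator (?E t) \<omega> \<partial>pathM)"
      unfolding hit_prob_def live_int_def by (intro nn_integral_cong) (auto simp: indicator_def)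
    then show ?thesis using E by simp
  qed
  moreover have "disjoint_family ?E"
    unfolding disjoint_family_on_def
  proof (intro ballI impI)
    fix s t :: nat assume "s \<noteq> t"
    then show "?E s \<inter> ?E t = {}"
      by (cases s t rule: linorder_cases) (auto simp: alive_def)
  qed
  moreover have "{\<omega> \<in> space pathM. hit_target M \<omega> < exit_safe M \<omega> \<and> hit_target M \<omega> < \<infinity>} = (\<Union>t. ?E t)"
  proof -
    have "{\<omega> \<in> space pathM. hit_target M \<omega> < exit_safe M \<omega> \<and> hit_target M \<omega> < \<infinity>} =
        {\<omega> \<in> space pathM. \<exists>t. alive M t \<omega> \<and> fst (\<omega> t) \<in> target M}"
      by (intro Collect_cong conj_cong refl hit_before_exit_iff) (simp add: space_path)
    then show ?thesis by auto
  qed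
  ultimately show ?thesis
    using E by (simp add: reach_prob_def emeasure_eq_measure[symmetric] suminf_emeasure image_subset_iff)
qed

end

section \<open>Value iteration\<close>

context reach_avoid
begin

primrec value_iter :: "nat \<Rightarrow> 'x \<Rightarrow> ennreal" where
  "value_iter 0 y = indicator (target M) y"
| "value_iter (Suc n) y =
     (if y \<in> target M then 1
      else if y \<in> safe M then SUP a\<in>feasible M y. expected (value_iter n) (y, a)
      else 0)"

lemma value_iter_target: "y \<in> target M \<Longrightarrow> value_iter n y = 1"
  by (cases n) auto

lemma value_iter_unsafe: "y \<notin> safe M \<Longrightarrow> value_iter n y = 0"
  using target_subset by (cases n) (auto simp: indicator_def)

lemma pair_feasible: "y \<in> safe M \<Longrightarrow> a \<in> feasible M y \<Longrightarrow> (y, a) \<in> feasible_pairs M"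
  using safe_subset by (auto simp: feasible_pairs_def)

lemma value_iter_le_1: "value_iter n y \<le> 1"
proof (induction n arbitrary: y)
  case (Suc n)
  then show ?case
    by (auto intro!: SUP_least expected_le_1 pair_feasible)
qed (simp add: indicator_def)

lemma value_iter_mono_Suc: "value_iter n y \<le> value_iter (Suc n) y"
proof (induction n arbitrary: y)
  case (Suc n)
  have "(SUP a\<in>feasible M y. expected (value_iter n) (y, a)) \<le>
      (SUP a\<in>feasible M y. expected (value_iter (Suc n)) (y, a))" if "y \<in> safe M"
    using that by (intro SUP_subset_mono order_refl) (auto intro!: Suc expected_mono pair_feasible simp del: value_iter.simps)
  then show ?case by simp
qed (auto simp: indicator_def)

lemma incseq_value_iter: "incseq (\<lambda>n. value_iter n)"
  by (intro incseq_SucI le_funI value_iter_mono_Suc)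

lemma expected_le_value_iter:
  assumes "y \<in> safe M - target M" "a \<in> feasible M y"
  shows "expected (value_iter n) (y, a) \<le> value_iter (Suc n) y"
  using assms by (auto intro: SUP_upper)

end

section \<open>Continuity in the action and measurable selectors\<close>

locale feller_reach_avoid = reach_avoid M
  for M :: "('x::polish_space, 'a::polish_space) reach_avoid_data" +
  assumes compact_valued: "\<And>y. y \<in> safe M - target M \<Longrightarrow> compact (feasible M y)"
    and weakly_measurable: "weakly_measurable_on (safe M - target M) (actions M) (feasible M)"
    and Feller: "strongly_Feller M"
begin

text \<open>The strong Feller property with the state held fixed. It is stated for real Bochner
  integrals, so the bound by 1 is used to translate \<open>u\<close> to a real function and
  back.\<close>

lemma expected_tendsto:
  assumes u: "u \<in> borel_measurable (state_space M)" and u1: "\<And>y. u y \<le> 1"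
    and y: "y \<in> safe M - target M" and s: "\<And>n. s n \<in> feasible M y" and a: "a \<in> feasible M y"
    and lim: "s \<longlonglongrightarrow> a"
  shows "(\<lambda>n. expected u (y, s n)) \<longlonglongrightarrow> expected u (y, a)"
proof -
  let ?g = "\<lambda>y. enn2real (u y)"
  let ?I = "\<lambda>z. \<integral>y. ?g y \<partial>trans_kernel M z"
  have bound: "?g y \<in> {0..1}" for y
    using u1[of y] by (auto intro: enn2real_leI)
  have u_eq: "u y = ennreal (?g y)" for y
    using u1[of y] by (metis ennreal_enn2real ennreal_one_less_top le_less_trans)
  have g: "?g \<in> borel_measurable (state_space M)"
    using u by measurable
  have "bounded (?g ` states M)"
    by (rule bounded_subset[OF bounded_closed_interval[of 0 1]]) (use bound in auto)
  with Feller g have cont: "continuous_on (live_pairs M) ?I"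
    by (auto simp: strongly_Feller_def)
  have live: "(y, b) \<in> live_pairs M" if "b \<in> feasible M y" for b
    using y that by (auto simp: live_pairs_def)
  have "(\<lambda>n. ?I (y, s n)) \<longlonglongrightarrow> ?I (y, a)"
    by (rule continuous_on_tendsto_compose[OF cont tendsto_Pair[OF tendsto_const lim]])
       (use live s a in auto)
  moreover have "expected u (y, b) = ennreal (?I (y, b))" if b: "b \<in> feasible M y" for b
  proof -
    have z: "(y, b) \<in> feasible_pairs M" using y b pair_feasible by auto
    interpret prob_space "trans_kernel M (y, b)" using z by (rule trans_kernel)
    have "integrable (trans_kernel M (y, b)) ?g"
      using g bound trans_kernel(2)[OF z]
      by (intro integrable_const_bound[where B=1]) (auto cong: measurable_cong_sets)
    then have "(\<integral>\<^sup>+x. ennreal (?g x) \<partial>trans_kernel M (y, b)) = ennreal (?I (y, b))"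
      by (intro nn_integral_eq_integral) auto
    then show ?thesis by (simp add: expected_def u_eq[symmetric])
  qed
  ultimately show ?thesis using s a by simp
qed

text \<open>A Castaing representation on \<open>safe M - target M\<close>, continued to the whole
  state space by the selector that the model provides.\<close>

lemma dense_selectors:
  obtains \<phi> :: "nat \<Rightarrow> 'x \<Rightarrow> 'a" where "\<And>k. \<phi> k \<in> state_space M \<rightarrow>\<^sub>M action_space M"
    and "\<And>k y. y \<in> states M \<Longrightarrow> \<phi> k y \<in> feasible M y"
    and "\<And>y. y \<in> safe M - target M \<Longrightarrow> feasible M y \<subseteq> closure (range (\<lambda>k. \<phi> k y))"
proof -
  let ?S = "safe M - target M"
  let ?N = "restrict_space (state_space M) ?S"
  have space_N: "space ?N = ?S"
    using safe_subset by (auto simp: space_restrict_space space_state_space)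
  have "states M \<inter> ?S = ?S" using safe_subset by auto
  then have sets_N: "sets ?N = sets (restrict_space borel ?S)"
    by (simp add: state_space_def sets_restrict_restrict_space)
  have feasible_actions: "feasible M y \<subseteq> actions M" if "y \<in> states M" for y
    using feasible[OF that] sets.sets_into_space by (metis space_action_space)
  from selector obtain f where f: "f \<in> state_space M \<rightarrow>\<^sub>M action_space M"
    and "\<forall>y\<in>states M. (y, f y) \<in> feasible_pairs M" by blast
  then have f_feas: "f y \<in> feasible M y" if "y \<in> states M" for y
    using that by (simp add: feasible_pairs_def)
  obtain \<psi> :: "nat \<Rightarrow> 'x \<Rightarrow> 'a" where \<psi>: "\<And>k. \<psi> k \<in> borel_measurable ?N"
    "\<And>k y. y \<in> ?S \<Longrightarrow> \<psi> k y \<in> feasible M y"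
    "\<And>y. y \<in> ?S \<Longrightarrow> feasible M y \<subseteq> closure (range (\<lambda>k. \<psi> k y))"
  proof (rule castaing_representation[of ?N "feasible M"])
    fix y assume "y \<in> space ?N"
    then show "closed (feasible M y)" "feasible M y \<noteq> {}"
      using compact_valued[of y] feasible[of y] safe_subset by (auto simp: space_N compact_imp_closed)
  next
    \<comment> \<open>Weak measurability concerns sets open relative to \<open>actions M\<close>;
      feasible sets lie in \<open>actions M\<close>, so intersecting \<open>G\<close> with it loses
      nothing.\<close>
    fix G :: "'a set" assume "open G"
    then have "openin (top_of_set (actions M)) (actions M \<inter> G)"
      by (rule openin_open_Int)
    then have "{y\<in>?S. feasible M y \<inter> (actions M \<inter> G) \<noteq> {}} \<in> sets ?N"
      using weakly_measurable by (auto simp: weakly_measurable_on_def sets_N)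
    also have "{y\<in>?S. feasible M y \<inter> (actions M \<inter> G) \<noteq> {}} = {y\<in>space ?N. feasible M y \<inter> G \<noteq> {}}"
      using feasible_actions safe_subset unfolding space_N by blast
    finally show "{y\<in>space ?N. feasible M y \<inter> G \<noteq> {}} \<in> sets ?N" .
  qed (auto simp: space_N)
  define \<phi> where "\<phi> k y = (if y \<in> ?S then \<psi> k y else f y)" for k y
  show ?thesis
  proof (rule that[of \<phi>])
    fix k
    have "\<phi> k \<in> borel_measurable (state_space M)"
      unfolding \<phi>_def[abs_def]
    proof (rule measurable_If_restrict_space_iff[THEN iffD2, OF _ conjI])
      show "{y \<in> space (state_space M). y \<in> ?S} \<in> sets (state_space M)" by measurable
      have "{y. y \<in> ?S} = ?S" by auto
      then show "\<psi> k \<in> borel_measurable (restrict_space (state_space M) {y. y \<in> ?S})"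
        using \<psi>(1)[of k] by simp
      show "f \<in> borel_measurable (restrict_space (state_space M) {y. y \<notin> ?S})"
        using f unfolding action_space_def
        by (intro measurable_restrict_space1) (auto simp: measurable_restrict_space2_iff)
    qed
    moreover have feas: "\<phi> k y \<in> feasible M y" if "y \<in> states M" for k y
      using \<psi>(2) f_feas that by (auto simp: \<phi>_def)
    ultimately show "\<phi> k \<in> state_space M \<rightarrow>\<^sub>M action_space M"
      unfolding action_space_def using feasible_actions
      by (intro measurable_restrict_space2) (auto simp: space_state_space)
    show "\<phi> k y \<in> feasible M y" if "y \<in> states M" for y
      using feas[OF that] .
  next
    fix y assume "y \<in> ?S"
    then show "feasible M y \<subseteq> closure (range (\<lambda>k. \<phi> k y))"
      using \<psi>(3) by (simp add: \<phi>_def)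
  qed
qed

text \<open>Continuity in the action lets a dense sequence of actions attain the same supremum,
  which thereby becomes countable.\<close>

lemma SUP_expected_selectors:
  assumes \<phi>: "\<And>k. \<phi> k y \<in> feasible M y" "feasible M y \<subseteq> closure (range (\<lambda>k. \<phi> k y))"
    and u: "u \<in> borel_measurable (state_space M)" "\<And>y. u y \<le> 1"
    and y: "y \<in> safe M - target M"
  shows "(SUP a\<in>feasible M y. expected u (y, a)) = (SUP k. expected u (y, \<phi> k y))"
proof (rule antisym)
  show "(SUP a\<in>feasible M y. expected u (y, a)) \<le> (SUP k. expected u (y, \<phi> k y))"
  proof (rule SUP_least)
    fix a assume a: "a \<in> feasible M y"
    then obtain s where s: "\<And>n. s n \<in> range (\<lambda>k. \<phi> k y)" and "s \<longlonglongrightarrow> a"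
      using \<phi>(2) by (metis closure_sequential subsetD)
    have "s n \<in> feasible M y" for n
      using s[of n] \<phi>(1) by auto
    with \<open>s \<longlonglongrightarrow> a\<close> have lim: "(\<lambda>n. expected u (y, s n)) \<longlonglongrightarrow> expected u (y, a)"
      by (intro expected_tendsto u y a)
    show "expected u (y, a) \<le> (SUP k. expected u (y, \<phi> k y))"
    proof (rule LIMSEQ_le_const2[OF lim], intro exI allI impI)
      fix n
      obtain k where "s n = \<phi> k y" using s[of n] by auto
      then show "expected u (y, s n) \<le> (SUP k. expected u (y, \<phi> k y))"
        by (auto intro: SUP_upper)
    qed
  qed
qed (use \<phi>(1) in \<open>auto intro!: SUP_least SUP_upper\<close>)

lemma measurable_value_iter[measurable]: "value_iter n \<in> borel_measurable (state_space M)"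
proof (induction n)
  case (Suc n)
  obtain \<phi> :: "nat \<Rightarrow> 'x \<Rightarrow> 'a" where \<phi>: "\<And>k. \<phi> k \<in> state_space M \<rightarrow>\<^sub>M action_space M"
    "\<And>k y. y \<in> states M \<Longrightarrow> \<phi> k y \<in> feasible M y"
    "\<And>y. y \<in> safe M - target M \<Longrightarrow> feasible M y \<subseteq> closure (range (\<lambda>k. \<phi> k y))"
    using dense_selectors by metis
  have [measurable]: "(\<lambda>y. expected (value_iter n) (y, \<phi> k y)) \<in> borel_measurable (state_space M)" for k
    using \<phi> Suc by (intro measurable_expected_selector)
  have "(\<lambda>y. if y \<in> target M then 1 else if y \<in> safe M
      then SUP k. expected (value_iter n) (y, \<phi> k y) else 0) \<in> borel_measurable (state_space M)"
    by measurable
  moreover have "(SUP k. expected (value_iter n) (y, \<phi> k y)) = (SUP a\<in>feasible M y. expected (value_iter n) (y, a))"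
    if y: "y \<in> safe M - target M" for y
    using y safe_subset by (intro SUP_expected_selectors[symmetric] \<phi>(2) \<phi>(3) Suc value_iter_le_1) auto
  then have "(\<lambda>y. if y \<in> target M then 1 else if y \<in> safe M
      then SUP k. expected (value_iter n) (y, \<phi> k y) else 0) = value_iter (Suc n)"
    by (simp add: fun_eq_iff)
  ultimately show ?case by (simp only:)
qed simp

text \<open>Follow the first selector of the dense sequence that comes within the factor
  \<open>c\<close> of the supremum; a least index is measurable. A factor, unlike an additive error,
  needs no subtraction in \<open>ennreal\<close>.\<close>

lemma near_optimal_selector:
  assumes c: "c < 1"
  obtains \<psi> where "\<psi> \<in> state_space M \<rightarrow>\<^sub>M action_space M"
    and "\<And>y. y \<in> states M \<Longrightarrow> \<psi> y \<in> feasible M y"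
    and "\<And>y. y \<in> safe M - target M \<Longrightarrow> c * value_iter (Suc n) y \<le> expected (value_iter n) (y, \<psi> y)"
proof -
  obtain \<phi> :: "nat \<Rightarrow> 'x \<Rightarrow> 'a" where \<phi>: "\<And>k. \<phi> k \<in> state_space M \<rightarrow>\<^sub>M action_space M"
    "\<And>k y. y \<in> states M \<Longrightarrow> \<phi> k y \<in> feasible M y"
    "\<And>y. y \<in> safe M - target M \<Longrightarrow> feasible M y \<subseteq> closure (range (\<lambda>k. \<phi> k y))"
    using dense_selectors by metis
  define P where "P k y \<longleftrightarrow> c * value_iter (Suc n) y \<le> expected (value_iter n) (y, \<phi> k y)" for k y
  have [measurable]: "(\<lambda>y. expected (value_iter n) (y, \<phi> k y)) \<in> borel_measurable (state_space M)" for k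
    by (rule measurable_expected_selector[OF \<phi>(1,2) measurable_value_iter])
  have P: "Measurable.pred (state_space M) (P k)" for k
    unfolding P_def[abs_def] by measurable
  define \<psi> where "\<psi> y = \<phi> (LEAST k. P k y) y" for y
  show ?thesis
  proof (rule that[of \<psi>])
    show "\<psi> \<in> state_space M \<rightarrow>\<^sub>M action_space M"
      unfolding \<psi>_def[abs_def]
      by (rule measurable_compose_countable[OF _ measurable_Least]) (use \<phi> P in auto)
    show "\<psi> y \<in> feasible M y" if "y \<in> states M" for y
      using \<phi>(2)[OF that] by (simp add: \<psi>_def)
    fix y assume y: "y \<in> safe M - target M"
    have eq: "value_iter (Suc n) y = (SUP k. expected (value_iter n) (y, \<phi> k y))"
    proof -
      have "(SUP a\<in>feasible M y. expected (value_iter n) (y, a)) = (SUP k. expected (value_iter n) (y, \<phi> k y))"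
        using y safe_subset
        by (intro SUP_expected_selectors \<phi>(2) \<phi>(3) measurable_value_iter value_iter_le_1) auto
      with y show ?thesis by simp
    qed
    \<comment> \<open>At value 0 every index works. Otherwise the value is positive and finite, so
      \<open>c\<close> times it is strictly below the supremum and some term exceeds it.\<close>
    have "\<exists>k. P k y"
    proof (cases "value_iter (Suc n) y = 0")
      case False
      have "value_iter (Suc n) y < top"
        using value_iter_le_1[of "Suc n" y] by (metis ennreal_one_less_top le_less_trans)
      with False c have "c * value_iter (Suc n) y < value_iter (Suc n) y"
        using ennreal_mult_strict_right_mono[OF c, of "value_iter (Suc n) y"]
        by (simp add: zero_less_iff_neq_zero del: value_iter.simps)
      then have "c * value_iter (Suc n) y < (SUP k. expected (value_iter n) (y, \<phi> k y))"
        unfolding eq .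
      then obtain k where "c * value_iter (Suc n) y < expected (value_iter n) (y, \<phi> k y)"
        by (auto simp only: less_SUP_iff)
      then have "P k y" unfolding P_def by (rule less_imp_le)
      then show ?thesis ..
    qed (simp add: P_def del: value_iter.simps)
    then have "P (LEAST k. P k y) y" by (rule LeastI_ex)
    then show "c * value_iter (Suc n) y \<le> expected (value_iter n) (y, \<psi> y)"
      by (simp add: P_def \<psi>_def)
  qed
qed

end

section \<open>One-step comparison of hitting probabilities with value functions\<close>

context controlled
begin

lemma measurable_target_coord[measurable]:
  "(\<lambda>z. indicator (target M) (fst z) :: ennreal) \<in> borel_measurable (pair_space M)"
  by (rule measurable_compose[OF measurable_fst_pair_space]) simp

lemma measurable_live_expected:
  assumes u[measurable]: "u \<in> borel_measurable (state_space M)"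
  shows "(\<lambda>z. if fst z \<in> safe M - target M then expected u z else 0) \<in> borel_measurable (pair_space M)"
  by measurable

lemma hit_prob_add_live_int_Suc:
  assumes u: "u \<in> borel_measurable (state_space M)"
  shows "hit_prob t + live_int (Suc t) (\<lambda>z. u (fst z)) =
    live_int t (\<lambda>z. indicator (target M) (fst z) + (if fst z \<in> safe M - target M then expected u z else 0))"
  unfolding hit_prob_def live_int_Suc[OF u]
  by (rule live_int_add[symmetric, OF measurable_target_coord measurable_live_expected[OF u]])

text \<open>The supermartingale step, valid for every policy. It is applied to consecutive value
  iterates and, with \<open>u = v\<close>, to their limit.\<close>

lemma hit_prob_add_live_int_le:
  assumes u: "u \<in> borel_measurable (state_space M)"
    and target: "\<And>y. y \<in> target M \<Longrightarrow> 1 \<le> v y"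
    and live: "\<And>y a. y \<in> safe M - target M \<Longrightarrow> a \<in> feasible M y \<Longrightarrow> expected u (y, a) \<le> v y"
  shows "hit_prob t + live_int (Suc t) (\<lambda>z. u (fst z)) \<le> live_int t (\<lambda>z. v (fst z))"
  unfolding hit_prob_add_live_int_Suc[OF u]
  using target live by (intro live_int_mono) (auto simp: indicator_def feasible_pairs_def)

text \<open>The reverse step up to the factor \<open>c\<close>, for a policy that plays a
  near-optimal selector at time \<open>t\<close>. Unsafe states cost nothing because
  \<open>v\<close> vanishes there.\<close>

lemma live_int_deterministic_le:
  assumes u: "u \<in> borel_measurable (state_space M)" and v: "v \<in> borel_measurable (state_space M)"
    and \<phi>: "\<phi> \<in> state_space M \<rightarrow>\<^sub>M action_space M" "\<And>y. y \<in> states M \<Longrightarrow> \<phi> y \<in> feasible M y"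
    and det: "\<And>h y. \<pi> t (h, y) = return (action_space M) (\<phi> y)"
    and target: "\<And>y. y \<in> target M \<Longrightarrow> c * v y \<le> 1"
    and live: "\<And>y. y \<in> safe M - target M \<Longrightarrow> c * v y \<le> expected u (y, \<phi> y)"
    and unsafe: "\<And>y. y \<notin> safe M \<Longrightarrow> v y = 0"
  shows "c * live_int t (\<lambda>z. v (fst z)) \<le> hit_prob t + live_int (Suc t) (\<lambda>z. u (fst z))"
proof -
  have m: "(\<lambda>z. v (fst z)) \<in> borel_measurable (pair_space M)"
    by (rule measurable_compose[OF measurable_fst_pair_space v])
  have "c * live_int t (\<lambda>z. v (fst z)) = live_int t (\<lambda>z. c * v (fst z))"
    by (rule live_int_cmult[symmetric, OF m])
  also have "\<dots> \<le> live_int t (\<lambda>z. indicator (target M) (fst z) +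
      (if fst z \<in> safe M - target M then expected u (fst z, \<phi> (fst z)) else 0))"
    using target live unsafe by (intro live_int_mono) (auto simp: indicator_def)
  also have "\<dots> = live_int t (\<lambda>z. indicator (target M) (fst z) +
      (if fst z \<in> safe M - target M then expected u z else 0))"
    using live_int_deterministic[OF \<phi> det
        borel_measurable_add[OF measurable_target_coord measurable_live_expected[OF u]]]
    by simp
  also have "\<dots> = hit_prob t + live_int (Suc t) (\<lambda>z. u (fst z))"
    by (rule hit_prob_add_live_int_Suc[OF u, symmetric])
  finally show ?thesis .
qed

lemma sum_hit_prob_le: "(\<Sum>t<n. hit_prob t) \<le> ennreal (reach_prob M \<pi> x)"
  unfolding reach_prob_eq_suminf by (rule sum_le_suminf) auto

lemma reach_prob_le_1: "reach_prob M \<pi> x \<le> 1"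
  unfolding reach_prob_def by (rule prob_space.prob_le_1[OF prob_space_path])

end

locale feller_controlled = feller_reach_avoid M + controlled M \<pi> x
  for M :: "('x::polish_space, 'a::polish_space) reach_avoid_data"
    and \<pi> :: "('x, 'a) policy" and x :: 'x
begin

text \<open>Each elapsed step trades one hitting probability for one more iteration, so the
  induction on \<open>s\<close> shifts \<open>n\<close>, which must stay arbitrary.\<close>

lemma sum_hit_prob_le_value_iter:
  "(\<Sum>t<s. hit_prob t) + live_int s (\<lambda>z. value_iter n (fst z)) \<le> value_iter (n + s) x"
proof (induction s arbitrary: n)
  case 0
  show ?case using live_int_0[OF measurable_value_iter] by simp
next
  case (Suc s)
  have "hit_prob s + live_int (Suc s) (\<lambda>z. value_iter n (fst z)) \<le> live_int s (\<lambda>z. value_iter (Suc n) (fst z))"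
    by (rule hit_prob_add_live_int_le[OF measurable_value_iter])
       (auto simp only: value_iter_target expected_le_value_iter)
  then have "(\<Sum>t<Suc s. hit_prob t) + live_int (Suc s) (\<lambda>z. value_iter n (fst z)) \<le>
      (\<Sum>t<s. hit_prob t) + live_int s (\<lambda>z. value_iter (Suc n) (fst z))"
    by (simp add: add.assoc add_left_mono del: value_iter.simps)
  also have "\<dots> \<le> value_iter (Suc n + s) x" by (rule Suc)
  finally show ?case by simp
qed

lemma reach_prob_le_SUP: "ennreal (reach_prob M \<pi> x) \<le> (SUP n. value_iter n x)"
proof -
  have "(\<Sum>t<s. hit_prob t) \<le> (SUP n. value_iter n x)" for s
  proof -
    have "(\<Sum>t<s. hit_prob t) \<le> (\<Sum>t<s. hit_prob t) + live_int s (\<lambda>z. value_iter 0 (fst z))" by simp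
    also have "\<dots> \<le> value_iter (0 + s) x" by (rule sum_hit_prob_le_value_iter)
    also have "\<dots> \<le> (SUP n. value_iter n x)" by (rule SUP_upper) simp
    finally show ?thesis .
  qed
  then show ?thesis
    unfolding reach_prob_eq_suminf suminf_eq_SUP by (intro SUP_least)
qed

end

section \<open>Near-optimal deterministic policies and the limit of value iteration\<close>

context reach_avoid
begin

lemma deterministic_policy:
  assumes \<psi>: "\<And>t. \<psi> t \<in> state_space M \<rightarrow>\<^sub>M action_space M"
    and feas: "\<And>t y. y \<in> states M \<Longrightarrow> \<psi> t y \<in> feasible M y"
  shows "(\<lambda>t (h, y). return (action_space M) (\<psi> t y)) \<in> policies M"
  unfolding policies_def mem_Collect_eq
proof (intro allI conjI)
  fix t
  have "(\<lambda>hy. \<psi> t (snd hy)) \<in> history_space M t \<rightarrow>\<^sub>M action_space M"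
    unfolding history_space_def by (rule measurable_compose[OF measurable_snd \<psi>])
  from measurable_compose[OF this measurable_return_prob_space]
  show "(\<lambda>(h, y). return (action_space M) (\<psi> t y)) \<in> history_space M t \<rightarrow>\<^sub>M prob_algebra (action_space M)"
    by (simp add: split_def)
  show "\<forall>(h, y)\<in>space (history_space M t).
      measure (case (h, y) of (h, y) \<Rightarrow> return (action_space M) (\<psi> t y)) (feasible M y) = 1"
    using feas feasible
    by (auto simp: history_space_def space_pair_measure space_state_space measure_return)
qed

text \<open>The supremum defining \<open>optimal_value\<close> is taken in the reals and is
  meaningful only for a bounded family.\<close>

lemma bdd_above_reach_prob:
  assumes x: "x \<in> states M"
  shows "bdd_above ((\<lambda>\<pi>. reach_prob M \<pi> x) ` policies M)"
proof (rule bdd_aboveI2)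
  fix \<pi> assume "\<pi> \<in> policies M"
  then interpret controlled M \<pi> x using x by unfold_locales
  show "reach_prob M \<pi> x \<le> 1" by (rule reach_prob_le_1)
qed

end

context feller_reach_avoid
begin

lemma discounted_value_iter_le:
  assumes x: "x \<in> states M" and c: "c < 1"
  shows "c ^ n * value_iter n x \<le> ennreal (optimal_value M x)"
proof -
  have "\<exists>\<psi>. \<psi> \<in> state_space M \<rightarrow>\<^sub>M action_space M \<and> (\<forall>y\<in>states M. \<psi> y \<in> feasible M y) \<and>
      (\<forall>y\<in>safe M - target M. c * value_iter (Suc k) y \<le> expected (value_iter k) (y, \<psi> y))" for k
    using near_optimal_selector[OF c, of k] by metis
  then obtain \<psi> where \<psi>: "\<And>k. \<psi> k \<in> state_space M \<rightarrow>\<^sub>M action_space M"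
    "\<And>k y. y \<in> states M \<Longrightarrow> \<psi> k y \<in> feasible M y"
    "\<And>k y. y \<in> safe M - target M \<Longrightarrow> c * value_iter (Suc k) y \<le> expected (value_iter k) (y, \<psi> k y)"
    by metis
  \<comment> \<open>At time \<open>t < n\<close> there are \<open>n - t = Suc (n - Suc t)\<close>
    stages to go, hence this selector index. From time \<open>n\<close> on truncated subtraction
    gives index 0, still a feasible choice.\<close>
  define \<pi> where "\<pi> = (\<lambda>t (h :: nat \<Rightarrow> 'x \<times> 'a, y). return (action_space M) (\<psi> (n - Suc t) y))"
  have pol: "\<pi> \<in> policies M"
    unfolding \<pi>_def by (rule deterministic_policy) (use \<psi> in auto)
  interpret controlled M \<pi> x using pol x by unfold_locales
  have c1: "c * a \<le> a" for a
    using c mult_right_mono[of c 1 a] by simp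
  \<comment> \<open>Each step costs one factor \<open>c\<close>; the target probability collected so
    far plus the value with \<open>n - s\<close> stages left covers the rest.\<close>
  have "c ^ s * value_iter n x \<le> (\<Sum>t<s. hit_prob t) + live_int s (\<lambda>z. value_iter (n - s) (fst z))"
    if "s \<le> n" for s
    using that
  proof (induction s)
    case 0
    show ?case using live_int_0[OF measurable_value_iter] by simp
  next
    case (Suc s)
    then have n_s: "n - s = Suc (n - Suc s)" by simp
    have "c ^ Suc s * value_iter n x \<le>
        c * ((\<Sum>t<s. hit_prob t) + live_int s (\<lambda>z. value_iter (n - s) (fst z)))"
      using Suc by (simp add: mult.assoc mult_left_mono)
    also have "\<dots> = c * (\<Sum>t<s. hit_prob t) + c * live_int s (\<lambda>z. value_iter (Suc (n - Suc s)) (fst z))"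
      by (simp only: distrib_left n_s)
    also have "\<dots> \<le> (\<Sum>t<s. hit_prob t) +
        (hit_prob s + live_int (Suc s) (\<lambda>z. value_iter (n - Suc s) (fst z)))"
    proof (rule add_mono[OF c1 live_int_deterministic_le])
      show "\<pi> s (h, y) = return (action_space M) (\<psi> (n - Suc s) y)" for h y
        by (simp add: \<pi>_def)
      show "c * value_iter (Suc (n - Suc s)) y \<le> 1" for y
        using c1 value_iter_le_1 by (rule order_trans)
    qed (use \<psi> measurable_value_iter value_iter_unsafe in blast)+
    finally show ?case by (simp add: add.assoc)
  qed
  \<comment> \<open>At \<open>s = n\<close> the remainder is the integral of the target indicator,
    that is \<open>hit_prob n\<close>, which extends the sum to \<open>Suc n\<close> terms.\<close>
  from this[of n] have "c ^ n * value_iter n x \<le> (\<Sum>t<Suc n. hit_prob t)"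
    by (simp add: hit_prob_def)
  also have "\<dots> \<le> ennreal (reach_prob M \<pi> x)" by (rule sum_hit_prob_le)
  also have "\<dots> \<le> ennreal (optimal_value M x)"
    unfolding optimal_value_def
    by (intro ennreal_leI cSUP_upper pol bdd_above_reach_prob x)
  finally show ?thesis .
qed

text \<open>Every policy is bounded by the iterates. Conversely, for a fixed horizon
  \<open>n\<close> the loss \<open>c ^ n\<close> disappears as \<open>c\<close> tends to 1.\<close>

lemma optimal_value_eq_SUP:
  assumes x: "x \<in> states M"
  shows "ennreal (optimal_value M x) = (SUP n. value_iter n x)"
proof (rule antisym)
  let ?w = "SUP n. value_iter n x"
  have "?w \<le> 1" by (intro SUP_least value_iter_le_1)
  then have w: "ennreal (enn2real ?w) = ?w"
    by (metis ennreal_enn2real ennreal_one_less_top le_less_trans)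
  \<comment> \<open>The factor 0 suffices: any feasible selector shows that there are policies, as
    \<open>cSUP_least\<close> demands.\<close>
  obtain \<psi> where "\<psi> \<in> state_space M \<rightarrow>\<^sub>M action_space M" "\<And>y. y \<in> states M \<Longrightarrow> \<psi> y \<in> feasible M y"
    using near_optimal_selector[OF zero_less_one] by metis
  then have "policies M \<noteq> {}" using deterministic_policy[of "\<lambda>_. \<psi>"] by auto
  then have "optimal_value M x \<le> enn2real ?w"
    unfolding optimal_value_def
  proof (rule cSUP_least)
    fix \<pi> assume "\<pi> \<in> policies M"
    then interpret feller_controlled M \<pi> x using x by unfold_locales
    have "ennreal (reach_prob M \<pi> x) \<le> ennreal (enn2real ?w)"
      using reach_prob_le_SUP by (simp only: w)
    then show "reach_prob M \<pi> x \<le> enn2real ?w"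
      by (rule ennreal_le_iff[THEN iffD1, rotated]) simp
  qed
  from ennreal_leI[OF this] show "ennreal (optimal_value M x) \<le> ?w"
    by (simp only: w)
  show "?w \<le> ennreal (optimal_value M x)"
  proof (rule SUP_least)
    fix n
    let ?v = "value_iter n x" and ?V = "optimal_value M x"
    have "?v < top"
      using value_iter_le_1 by (metis ennreal_one_less_top le_less_trans)
    then have v: "ennreal (enn2real ?v) = ?v" by simp
    have V: "0 \<le> ?V"
    proof -
      obtain \<pi> where "\<pi> \<in> policies M" using \<open>policies M \<noteq> {}\<close> by auto
      then have "reach_prob M \<pi> x \<le> ?V"
        unfolding optimal_value_def by (intro cSUP_upper bdd_above_reach_prob x)
      then show ?thesis by (rule order_trans[rotated]) (simp add: reach_prob_def)
    qed
    have "enn2real ?v \<le> ?V"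
    proof (rule LIMSEQ_le_const2)
      have "(\<lambda>k. (1 - 1 / real (Suc k)) ^ n * enn2real ?v) \<longlonglongrightarrow> (1 - 0) ^ n * enn2real ?v"
        by (intro tendsto_intros LIMSEQ_Suc[OF lim_1_over_n])
      then show "(\<lambda>k. (1 - 1 / real (Suc k)) ^ n * enn2real ?v) \<longlonglongrightarrow> enn2real ?v" by simp
      show "\<exists>N. \<forall>k\<ge>N. (1 - 1 / real (Suc k)) ^ n * enn2real ?v \<le> ?V"
      proof (intro exI allI impI)
        fix k :: nat
        let ?c = "1 - 1 / real (Suc k)"
        have c: "0 \<le> ?c" "?c < 1" by auto
        then have "ennreal ?c < 1"
          using ennreal_lessI[of 1 ?c] by simp
        from discounted_value_iter_le[OF x this, of n]
        have "ennreal ?c ^ n * ennreal (enn2real ?v) \<le> ennreal ?V"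
          by (simp only: v)
        then show "?c ^ n * enn2real ?v \<le> ?V"
          using c(1) V by (simp only: ennreal_power ennreal_mult'[symmetric] ennreal_le_iff zero_le_power)
      qed
    qed
    from ennreal_leI[OF this] show "?v \<le> ennreal ?V"
      by (simp only: v)
  qed
qed

end

section \<open>Thrifty and equalizing policies\<close>

context feller_controlled
begin

text \<open>This is \<open>1_K V^*\<close> in \<open>ennreal\<close>, since the iterates vanish off
  the safe set. As a countable supremum it is visibly measurable, which a supremum over policies is
  not.\<close>

definition iter_limit :: "'x \<Rightarrow> ennreal" where
  "iter_limit y = (SUP n. value_iter n y)"

lemma measurable_iter_limit[measurable]: "iter_limit \<in> borel_measurable (state_space M)"
  unfolding iter_limit_def[abs_def] by measurable

lemma iter_limit_le_1: "iter_limit y \<le> 1"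
  unfolding iter_limit_def by (intro SUP_least value_iter_le_1)

lemma iter_limit_eq:
  assumes "y \<in> states M"
  shows "enn2real (iter_limit y) = indicator (safe M) y * optimal_value M y"
proof (cases "y \<in> safe M")
  case True
  have "0 \<le> optimal_value M y"
    unfolding optimal_value_def
    by (rule cSUP_upper2[OF bdd_above_reach_prob[OF assms] policy]) (simp add: reach_prob_def)
  with True show ?thesis
    by (simp add: iter_limit_def flip: optimal_value_eq_SUP[OF assms])
qed (simp add: iter_limit_def value_iter_unsafe)

text \<open>Monotone convergence moves \<open>Q\<close> inside the limit of the iterates, where each
  step is bounded by the next iterate.\<close>

lemma expected_iter_limit_le:
  assumes y: "y \<in> safe M - target M" and a: "a \<in> feasible M y"
  shows "expected iter_limit (y, a) \<le> iter_limit y"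
proof -
  have ya: "(y, a) \<in> feasible_pairs M" using y a pair_feasible by auto
  have "expected iter_limit (y, a) = (SUP n. expected (value_iter n) (y, a))"
    unfolding expected_def iter_limit_def
  proof (rule nn_integral_monotone_convergence_SUP[OF incseq_value_iter])
    show "value_iter n \<in> borel_measurable (trans_kernel M (y, a))" for n
      using measurable_value_iter by (simp add: trans_kernel(2)[OF ya] cong: measurable_cong_sets)
  qed
  also have "\<dots> \<le> iter_limit y"
    unfolding iter_limit_def
  proof (rule SUP_least)
    fix n
    have "expected (value_iter n) (y, a) \<le> value_iter (Suc n) y"
      using y a by (rule expected_le_value_iter)
    also have "\<dots> \<le> (SUP n. value_iter n y)" by (rule SUP_upper) simp
    finally show "expected (value_iter n) (y, a) \<le> (SUP n. value_iter n y)" .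
  qed
  finally show ?thesis .
qed

definition live_value :: "nat \<Rightarrow> ennreal" where
  "live_value t = live_int t (\<lambda>z. iter_limit (fst z))"

lemma live_value_le_1: "live_value t \<le> 1"
  unfolding live_value_def by (intro live_int_le_1 iter_limit_le_1)

lemma hit_prob_le_1: "hit_prob t \<le> 1"
  unfolding hit_prob_def by (intro live_int_le_1) (simp add: indicator_def)

lemma finite_hit_prob: "hit_prob t < top" and finite_live_value: "live_value t < top"
  using hit_prob_le_1[of t] live_value_le_1[of t] ennreal_one_less_top by (auto intro: le_less_trans)

lemma live_value_0: "live_value 0 = ennreal (optimal_value M x)"
  unfolding live_value_def live_int_0[OF measurable_iter_limit]
  by (simp only: iter_limit_def optimal_value_eq_SUP[OF initial])

lemma live_value_Suc: "hit_prob t + live_value (Suc t) \<le> live_value t"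
  unfolding live_value_def
proof (rule hit_prob_add_live_int_le[OF measurable_iter_limit])
  fix y assume "y \<in> target M"
  then show "1 \<le> iter_limit y"
    using SUP_upper[of 0 UNIV "\<lambda>n. value_iter n y"] by (simp add: iter_limit_def)
qed (rule expected_iter_limit_le)

lemma remaining_value_path:
  assumes "\<omega> \<in> space pathM"
  shows "remaining_value M (Suc n) \<omega> = enn2real (if alive M (Suc n) \<omega> then iter_limit (fst (\<omega> (Suc n))) else 0)"
proof -
  have "\<forall>t. \<omega> t \<in> feasible_pairs M" using assms by (simp add: space_path)
  then show ?thesis
    using iter_limit_eq[OF feasible_pairs_fst, of "\<omega> (Suc n)"] by (simp add: remaining_value_eq)
qed

lemma reward_path:
  assumes "\<omega> \<in> space pathM"
  shows "reward M (Suc n) \<omega> =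
    (\<Sum>t<Suc n. enn2real (if alive M t \<omega> then indicator (target M) (fst (\<omega> t)) else 0))"
proof -
  have "\<forall>t. \<omega> t \<in> feasible_pairs M" using assms by (simp add: space_path)
  then show ?thesis
    by (auto simp: reward_eq indicator_def simp del: sum.lessThan_Suc intro!: sum.cong)
qed

text \<open>The bridge from \<open>ennreal\<close> to the Bochner integrals of the definitions: the
  bound by 1 gives integrability and makes \<open>enn2real\<close> lossless.\<close>

lemma integral_enn2real_live:
  assumes g[measurable]: "g \<in> borel_measurable (pair_space M)"
    and g1: "\<And>z. z \<in> feasible_pairs M \<Longrightarrow> g z \<le> 1"
  shows "integrable pathM (\<lambda>\<omega>. enn2real (if alive M t \<omega> then g (\<omega> t) else 0))"
    and "(\<integral>\<omega>. enn2real (if alive M t \<omega> then g (\<omega> t) else 0) \<partial>pathM) = enn2real (live_int t g)"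
proof -
  interpret prob_space pathM by (rule prob_space_path)
  let ?f = "\<lambda>\<omega>. if alive M t \<omega> then g (\<omega> t) else 0"
  have f1: "?f \<omega> \<le> 1" if "\<omega> \<in> space pathM" for \<omega>
    using g1 that by (simp add: space_path)
  have m: "(\<lambda>\<omega>. enn2real (?f \<omega>)) \<in> borel_measurable pathM"
    by measurable
  show "integrable pathM (\<lambda>\<omega>. enn2real (?f \<omega>))"
  proof (rule integrable_const_bound[where B=1])
    show "AE \<omega> in pathM. norm (enn2real (?f \<omega>)) \<le> 1"
    proof (rule AE_I2)
      fix \<omega> assume "\<omega> \<in> space pathM"
      from enn2real_leI[of 1, OF _] f1[OF this] show "norm (enn2real (?f \<omega>)) \<le> 1" by simp
    qed
  qed (rule m)
  have "(\<integral>\<omega>. enn2real (?f \<omega>) \<partial>pathM) = enn2real (\<integral>\<^sup>+\<omega>. ennreal (enn2real (?f \<omega>)) \<partial>pathM)"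
    by (rule integral_eq_nn_integral[OF m]) simp
  also have "(\<integral>\<^sup>+\<omega>. ennreal (enn2real (?f \<omega>)) \<partial>pathM) = (\<integral>\<^sup>+\<omega>. ?f \<omega> \<partial>pathM)"
  proof (rule nn_integral_cong)
    fix \<omega> assume "\<omega> \<in> space pathM"
    then have "?f \<omega> < top" by (rule le_less_trans[OF f1 ennreal_one_less_top])
    then show "ennreal (enn2real (?f \<omega>)) = ?f \<omega>" by (rule ennreal_enn2real)
  qed
  finally show "(\<integral>\<omega>. enn2real (?f \<omega>) \<partial>pathM) = enn2real (live_int t g)"
    by (simp only: live_int_def)
qed

lemma measurable_iter_limit_fst: "(\<lambda>z. iter_limit (fst z)) \<in> borel_measurable (pair_space M)"
  by (rule measurable_compose[OF measurable_fst_pair_space measurable_iter_limit])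

lemma integral_remaining_value:
  "(\<integral>\<omega>. remaining_value M (Suc n) \<omega> \<partial>pathM) = enn2real (live_value (Suc n))"
  unfolding live_value_def integral_enn2real_live(2)[OF measurable_iter_limit_fst iter_limit_le_1, symmetric]
  by (rule Bochner_Integration.integral_cong[OF refl remaining_value_path])

text \<open>The reward at index \<open>Suc n\<close> counts hits at times \<open>0\<close> to
  \<open>n\<close>, so its expectation has exactly the terms \<open>t < Suc n\<close>.\<close>

lemma integral_zeta:
  "(\<integral>\<omega>. zeta M x (Suc n) \<omega> \<partial>pathM) =
    (\<Sum>t<Suc n. enn2real (hit_prob t)) + enn2real (live_value (Suc n))"
proof -
  let ?r = "\<lambda>t \<omega>. enn2real (if alive M t \<omega> then indicator (target M) (fst (\<omega> t)) else 0)"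
  let ?v = "\<lambda>\<omega>. enn2real (if alive M (Suc n) \<omega> then iter_limit (fst (\<omega> (Suc n))) else 0)"
  have ind: "indicator (target M) (fst z) \<le> (1 :: ennreal)" for z :: "'x \<times> 'a"
    by (simp add: indicator_def)
  note r = integral_enn2real_live[OF measurable_target_coord ind]
  note v = integral_enn2real_live[OF measurable_iter_limit_fst iter_limit_le_1]
  have "(\<integral>\<omega>. zeta M x (Suc n) \<omega> \<partial>pathM) = (\<integral>\<omega>. (\<Sum>t<Suc n. ?r t \<omega>) + ?v \<omega> \<partial>pathM)"
    by (rule Bochner_Integration.integral_cong[OF refl])
       (simp add: zeta_def reward_path remaining_value_path del: sum.lessThan_Suc)
  also have "\<dots> = (\<integral>\<omega>. (\<Sum>t<Suc n. ?r t \<omega>) \<partial>pathM) + (\<integral>\<omega>. ?v \<omega> \<partial>pathM)"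
    by (intro Bochner_Integration.integral_add Bochner_Integration.integrable_sum r v)
  also have "(\<integral>\<omega>. (\<Sum>t<Suc n. ?r t \<omega>) \<partial>pathM) = (\<Sum>t<Suc n. \<integral>\<omega>. ?r t \<omega> \<partial>pathM)"
    by (intro Bochner_Integration.integral_sum r)
  finally show ?thesis
    by (simp only: r(2) v(2) hit_prob_def live_value_def)
qed

lemma sum_hit_prob_tendsto: "(\<lambda>n. \<Sum>t<n. enn2real (hit_prob t)) \<longlonglongrightarrow> reach_prob M \<pi> x"
proof (rule tendsto_ennrealD)
  have "(\<lambda>n. \<Sum>t<n. hit_prob t) \<longlonglongrightarrow> (\<Sum>t. hit_prob t)"
    by (rule summable_LIMSEQ) simp
  then show "(\<lambda>n. ennreal (\<Sum>t<n. enn2real (hit_prob t))) \<longlonglongrightarrow> ennreal (reach_prob M \<pi> x)"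
    by (simp add: reach_prob_eq_suminf sum_ennreal[symmetric] finite_hit_prob)
qed (auto simp: reach_prob_def intro!: always_eventually sum_nonneg)

lemma thrifty_equalizing:
  "(equalizing M \<pi> x \<longleftrightarrow> (\<lambda>n. \<integral>\<omega>. remaining_value M n \<omega> \<partial>pathM) \<longlonglongrightarrow> 0)
    \<and> (optimal_at M \<pi> x \<longleftrightarrow> thrifty M \<pi> x \<and> equalizing M \<pi> x)"
proof -
  define S where "S n = (\<Sum>t<n. enn2real (hit_prob t))" for n
  define r where "r n = enn2real (live_value n)" for n
  let ?V = "reach_prob M \<pi> x"
  have S: "S \<longlonglongrightarrow> ?V"
    unfolding S_def[abs_def] by (rule sum_hit_prob_tendsto)
  have r_nonneg: "0 \<le> r n" and S_nonneg: "0 \<le> S n" for n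
    by (auto simp: r_def S_def intro: sum_nonneg)
  \<comment> \<open>Finiteness carries \<open>live_value_Suc\<close> over to the reals; adding
    \<open>S n\<close> shows that \<open>S + r\<close>, hence the expectation of
    \<open>zeta\<close>, decreases.\<close>
  have "enn2real (hit_prob n) + r (Suc n) \<le> r n" for n
    using enn2real_mono[OF live_value_Suc finite_live_value, of n]
    by (simp add: r_def enn2real_plus finite_hit_prob finite_live_value)
  then have dec: "decseq (\<lambda>n. S n + r n)"
    by (intro decseq_SucI) (simp add: S_def add.assoc)
  then obtain L where L: "(\<lambda>n. S n + r n) \<longlonglongrightarrow> L"
    by (rule decseq_convergent[where B=0]) (simp add: r_nonneg S_nonneg)
  have "?V \<le> optimal_value M x"
    unfolding optimal_value_def by (intro cSUP_upper policy bdd_above_reach_prob initial)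
  moreover have "0 \<le> ?V" by (simp add: reach_prob_def)
  ultimately have "r 0 = optimal_value M x"
    by (simp add: r_def live_value_0)
  then have L_le: "L \<le> optimal_value M x"
    using decseq_ge[OF dec L, of 0] by (simp add: S_def)
  have V_le: "?V \<le> L"
    using S L by (rule LIMSEQ_le) (simp add: r_nonneg)
  have "(\<lambda>n. \<integral>\<omega>. zeta M x n \<omega> \<partial>pathM) \<longlonglongrightarrow> L"
  \<comment> \<open>\<open>zeta\<close> is defined separately at index 0, so the limit is taken
    along successors.\<close>
  proof (rule LIMSEQ_imp_Suc)
    show "(\<lambda>n. \<integral>\<omega>. zeta M x (Suc n) \<omega> \<partial>pathM) \<longlonglongrightarrow> L"
      using LIMSEQ_Suc[OF L] by (simp only: integral_zeta S_def r_def)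
  qed
  then have limit: "limit_value M \<pi> x = L"
    unfolding limit_value_def by (rule limI)
  have r: "r \<longlonglongrightarrow> L - ?V"
    using tendsto_diff[OF L S] by simp
  have "(\<lambda>n. \<integral>\<omega>. remaining_value M n \<omega> \<partial>pathM) \<longlonglongrightarrow> L - ?V"
  \<comment> \<open>At index 0 the truncated \<open>n - 1\<close> is again 0 and the formula for the
    expectation differs; the shift avoids it.\<close>
  proof (rule LIMSEQ_imp_Suc)
    show "(\<lambda>n. \<integral>\<omega>. remaining_value M (Suc n) \<omega> \<partial>pathM) \<longlonglongrightarrow> L - ?V"
      using LIMSEQ_Suc[OF r] by (simp only: integral_remaining_value r_def)
  qed
  then have "(\<lambda>n. \<integral>\<omega>. remaining_value M n \<omega> \<partial>pathM) \<longlonglongrightarrow> 0 \<longleftrightarrow> L = ?V"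
    using LIMSEQ_unique by force
  \<comment> \<open>As \<open>L\<close> lies between \<open>V(\<pi>, x)\<close> and the optimal
    value, the two ends agree exactly when both inequalities are equalities.\<close>
  with L_le V_le limit show ?thesis
    by (auto simp: equalizing_def thrifty_def optimal_at_def)
qed

end

theorem theorem2p17:
  fixes M :: "('x::polish_space, 'a::polish_space) reach_avoid_data"
    and \<pi> :: "('x, 'a) policy" and x :: 'x
  assumes model: "reach_avoid M"
    and compact_valued: "\<And>y. y \<in> safe M - target M \<Longrightarrow> compact (feasible M y)"
    and uhc: "upper_hemicontinuous_on (safe M - target M) (actions M) (feasible M)"
    and weakly_measurable: "weakly_measurable_on (safe M - target M) (actions M) (feasible M)"
    and Feller: "strongly_Feller M"
    and policy: "\<pi> \<in> policies M"
    and x: "x \<in> states M"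
  shows "(equalizing M \<pi> x \<longleftrightarrow>
            (\<lambda>n. \<integral>\<omega>. remaining_value M n \<omega> \<partial>path_law M \<pi> x) \<longlonglongrightarrow> 0)
       \<and> (optimal_at M \<pi> x \<longleftrightarrow> thrifty M \<pi> x \<and> equalizing M \<pi> x)"
proof -
  interpret reach_avoid M by (rule model)
  interpret feller_controlled M \<pi> x
    by unfold_locales (fact compact_valued weakly_measurable Feller policy x)+
  show ?thesis by (rule thrifty_equalizing)
qed

end
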